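(* Let $a,b,c,u,v,x,y,q$ be indeterminates and let $\mathbf J=[J_{n,k}]_{n,k\ge0}$ be defined by $J_{0,0}=1$, $J_{n,k}=0$ unless $0\le k\le n$, and $$J_{n,k}=\delta_{k-1}J_{n-1,k-1}+\gamma_kJ_{n-1,k}+\beta_{k+1}J_{n-1,k+1}\quad(n\ge1),$$ with $\delta_k=(ak+b)[u(k+1)+v]$, $\gamma_k=(ax+cu)k^2+(ay+bx+cv)k+by$, $\beta_{k+1}=c(y+kx)(k+1)$. Let $J_n(q)=\sum_kJ_{n,k}q^k$ and $J_n^*(q)=q^nJ_n(1/q)$. Then: (i) the binomial row-generating matrix $\mathbf J(q)=\mathbf J\mathbf B_q$ is coefficientwise totally positive in $(a,b,c,u,v,x,y,q)$; (ii) both $(J_n(q))_{n\ge0}$ and $(J_n^*(q))_{n\ge0}$ are coefficientwise Hankel-totally positive in $(a,b,c,u,v,x,y,q)$ and $3$-$(a,b,c,u,v,x,y,q)$-log-convex; (iii) $(J_{n,0})_{n\ge0}$ is coefficientwise Hankel-totally positive in $(a,b,c,u,v,x,y)$ and $3$-$(a,b,c,u,v,x,y,q)$-log-convex; (iv) for all real $a,b,c,u,v,x,y\ge0$, the convolution $r_n=\sum_kJ_{n,k}s_kt_{n-k}$ preserves the Stieltjes moment property (if $(s_n)$ and $(t_n)$ are Stieltjes moment sequences, so is $(r_n)$).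
   Context: $\mathbf B_q=[\binom nkq^{n-k}]_{n,k\ge0}$. A matrix is coefficientwise totally positive in given indeterminates if all minors are polynomials with nonnegative coefficients; a sequence $(a_n)$ is coefficientwise Hankel-totally positive if $[a_{i+j}]_{i,j\ge0}$ is. For polynomials $(a_n)$ in indeterminates $\mathbf z$: $\mathcal L[a_i]=a_{i-1}a_{i+1}-a_i^2$, $\mathcal L^k=\mathcal L(\mathcal L^{k-1})$; $3$-$\mathbf z$-log-convex means $\mathcal L^k[a_i]$ has nonnegative coefficients in $\mathbf z$ for all $k\le3$. A real sequence $(a_n)$ is a Stieltjes moment sequence if $a_n=\int_0^\infty x^nd\mu(x)$ for some nonnegative measure $\mu$ on $[0,\infty)$. *)

theory Defs
  imports
    "HOL-Analysis.Analysis"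
    "HOL-Library.Poly_Mapping"
    "Jordan_Normal_Form.Determinant"
begin

text \<open>Polynomials in indeterminates of type \<open>'v\<close> over \<open>'a\<close>: finitely supported functions from
  monomials (exponent vectors) to coefficients. The ring structure (convolution product) is the
  one of \<^theory>\<open>HOL-Library.Poly_Mapping\<close>.\<close>

type_synonym ('v, 'a) mpoly = "('v \<Rightarrow>\<^sub>0 nat) \<Rightarrow>\<^sub>0 'a"

definition Var :: "'v \<Rightarrow> ('v, 'a::zero_neq_one) mpoly" where
  "Var i = Poly_Mapping.single (Poly_Mapping.single i 1) 1"

definition vars :: "('v, 'a::zero) mpoly \<Rightarrow> 'v set" where
  "vars p = (\<Union>m\<in>Poly_Mapping.keys p. Poly_Mapping.keys m)"

definition coeffwise_nonneg :: "'v set \<Rightarrow> ('v, real) mpoly \<Rightarrow> bool" where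
  "coeffwise_nonneg Z p \<longleftrightarrow> vars p \<subseteq> Z \<and> (\<forall>m. Poly_Mapping.lookup p m \<ge> 0)"

text \<open>Infinite matrices are functions \<open>nat \<Rightarrow> nat \<Rightarrow> 'a\<close> (row, column). \<open>minor A m r c\<close> is the
  \<open>m \<times> m\<close> minor on rows \<open>r 0, \<dots>, r (m - 1)\<close> and columns \<open>c 0, \<dots>, c (m - 1)\<close>.\<close>

definition minor :: "(nat \<Rightarrow> nat \<Rightarrow> 'a::comm_ring_1) \<Rightarrow> nat \<Rightarrow> (nat \<Rightarrow> nat) \<Rightarrow> (nat \<Rightarrow> nat) \<Rightarrow> 'a" where
  "minor A m r c = Determinant.det (Matrix.mat m m (\<lambda>(i, j). A (r i) (c j)))"

definition coeffwise_TP :: "'v set \<Rightarrow> (nat \<Rightarrow> nat \<Rightarrow> ('v, real) mpoly) \<Rightarrow> bool" where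
  "coeffwise_TP Z A \<longleftrightarrow>
     (\<forall>m r c. strict_mono_on {..<m} r \<and> strict_mono_on {..<m} c \<longrightarrow>
        coeffwise_nonneg Z (minor A m r c))"

definition hankel :: "(nat \<Rightarrow> 'a) \<Rightarrow> nat \<Rightarrow> nat \<Rightarrow> 'a" where
  "hankel s i j = s (i + j)"

definition coeffwise_Hankel_TP :: "'v set \<Rightarrow> (nat \<Rightarrow> ('v, real) mpoly) \<Rightarrow> bool" where
  "coeffwise_Hankel_TP Z s \<longleftrightarrow> coeffwise_TP Z (hankel s)"

text \<open>\<open>LC s i\<close> is meaningful only for \<open>i \<ge> 1\<close>, so the \<open>k\<close>-fold iterate is meaningful only for
  \<open>i \<ge> k\<close>; the value at smaller \<open>i\<close> (where \<open>i - 1\<close> truncates) is junk and never used.\<close>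

definition LC :: "(nat \<Rightarrow> 'a::comm_ring_1) \<Rightarrow> nat \<Rightarrow> 'a" where
  "LC s i = s (i - 1) * s (i + 1) - (s i)\<^sup>2"

definition coeffwise_log_convex :: "nat \<Rightarrow> 'v set \<Rightarrow> (nat \<Rightarrow> ('v, real) mpoly) \<Rightarrow> bool" where
  "coeffwise_log_convex r Z s \<longleftrightarrow> (\<forall>k\<le>r. \<forall>i\<ge>k. coeffwise_nonneg Z ((LC ^^ k) s i))"

definition Stieltjes_moment_seq :: "(nat \<Rightarrow> real) \<Rightarrow> bool" where
  "Stieltjes_moment_seq s \<longleftrightarrow>
     (\<exists>\<mu>::real measure. sets \<mu> = sets (restrict_space borel {0..}) \<and>
        (\<forall>n. integrable \<mu> (\<lambda>t. t ^ n) \<and> s n = (\<integral>t. t ^ n \<partial>\<mu>)))"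

text \<open>The parameters of the recurrence range over any commutative ring, so that they can be
  indeterminates as well as real numbers.\<close>

definition delta :: "'a::comm_ring_1 \<Rightarrow> 'a \<Rightarrow> 'a \<Rightarrow> 'a \<Rightarrow> nat \<Rightarrow> 'a" where
  "delta a b u v k = (a * of_nat k + b) * (u * of_nat (k + 1) + v)"

definition gamma ::
  "'a::comm_ring_1 \<Rightarrow> 'a \<Rightarrow> 'a \<Rightarrow> 'a \<Rightarrow> 'a \<Rightarrow> 'a \<Rightarrow> 'a \<Rightarrow> nat \<Rightarrow> 'a" where
  "gamma a b c u v x y k =
     (a * x + c * u) * (of_nat k)\<^sup>2 + (a * y + b * x + c * v) * of_nat k + b * y"

text \<open>\<open>beta_Suc c x y k\<close> is \<open>\<beta>\<close> with index \<open>k + 1\<close>.\<close>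

definition beta_Suc :: "'a::comm_ring_1 \<Rightarrow> 'a \<Rightarrow> 'a \<Rightarrow> nat \<Rightarrow> 'a" where
  "beta_Suc c x y k = c * (y + of_nat k * x) * of_nat (k + 1)"

primrec Jmat ::
  "'a::comm_ring_1 \<Rightarrow> 'a \<Rightarrow> 'a \<Rightarrow> 'a \<Rightarrow> 'a \<Rightarrow> 'a \<Rightarrow> 'a \<Rightarrow> nat \<Rightarrow> nat \<Rightarrow> 'a" where
  "Jmat a b c u v x y 0 = (\<lambda>k. if k = 0 then 1 else 0)"
| "Jmat a b c u v x y (Suc n) =
     (\<lambda>k. (if k = 0 then 0 else delta a b u v (k - 1) * Jmat a b c u v x y n (k - 1))
        + gamma a b c u v x y k * Jmat a b c u v x y n k
        + beta_Suc c x y k * Jmat a b c u v x y n (k + 1))"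

lemma Jmat_eq_0: "n < k \<Longrightarrow> Jmat a b c u v x y n k = 0"
  by (induction n arbitrary: k) auto

text \<open>Product of infinite matrices, the left factor being lower triangular.\<close>

definition lower_mult ::
  "(nat \<Rightarrow> nat \<Rightarrow> 'a::comm_ring_1) \<Rightarrow> (nat \<Rightarrow> nat \<Rightarrow> 'a) \<Rightarrow> nat \<Rightarrow> nat \<Rightarrow> 'a" where
  "lower_mult A B n k = (\<Sum>j\<le>n. A n j * B j k)"

text \<open>For \<open>k > n\<close> the binomial coefficient vanishes.\<close>

definition binomial_mat :: "'a::comm_ring_1 \<Rightarrow> nat \<Rightarrow> nat \<Rightarrow> 'a" where
  "binomial_mat q n k = of_nat (n choose k) * q ^ (n - k)"

definition row_poly :: "(nat \<Rightarrow> nat \<Rightarrow> 'a::comm_ring_1) \<Rightarrow> 'a \<Rightarrow> nat \<Rightarrow> 'a" where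
  "row_poly A q n = (\<Sum>k\<le>n. A n k * q ^ k)"

text \<open>\<open>q\<^sup>n A\<^sub>n(1/q)\<close>, where \<open>A\<^sub>n(q)\<close> is the row polynomial, written out without division by \<open>q\<close>.\<close>

definition rev_row_poly :: "(nat \<Rightarrow> nat \<Rightarrow> 'a::comm_ring_1) \<Rightarrow> 'a \<Rightarrow> nat \<Rightarrow> 'a" where
  "rev_row_poly A q n = (\<Sum>k\<le>n. A n k * q ^ (n - k))"

datatype indet = Ia | Ib | Ic | Iu | Iv | Ix | Iy | Iq

abbreviation J_indet :: "nat \<Rightarrow> nat \<Rightarrow> (indet, real) mpoly" where
  "J_indet \<equiv> Jmat (Var Ia) (Var Ib) (Var Ic) (Var Iu) (Var Iv) (Var Ix) (Var Iy)"

end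

theory Submission
  imports Defs "HOL-Probability.Helly_Selection"
    "HOL-Computational_Algebra.Fundamental_Theorem_Algebra"
begin

hide_const (open) Module.smult

text \<open>
  The tridiagonal recursion matrix of \<open>J\<close> factors into a lower and an upper bidiagonal matrix.
  Conjugating it by \<open>B\<^sub>q\<close> yields the recursion matrix of \<open>J B\<^sub>q\<close>, which again is a product of
  matrices whose consecutive rows (or columns) overlap in at most one position. Such staircase
  matrices are totally positive, and by the Cauchy--Binet formula total positivity passes to
  products, hence to \<open>J B\<^sub>q\<close> and to the Hankel matrix of its zeroth column. All this works over
  any subset of a commutative ring closed under sums and products. Reversed row
  polynomials arise by scaling \<open>c, x, y\<close> by \<open>q\<close>, the zeroth column of \<open>J\<close> by setting \<open>q = 0\<close>.
  Log-convexity up to order \<open>3\<close> follows from Dodgson condensation.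

  For the convolution, write it as a double integral of the sequences
  \<open>\<Sum>\<^sub>k J\<^sub>n\<^sub>,\<^sub>k p\<^sup>k z\<^sup>n\<^sup>-\<^sup>k\<close> with \<open>p, z \<ge> 0\<close>. Their Hankel matrices are totally positive, hence
  positive semidefinite, and so are those of the convolution. Stieltjes' theorem then provides the
  measure: the moment functional is nonnegative on polynomials that are nonnegative on the
  half-line, so the sequence is a limit of moment sequences of finitely supported measures, and
  Helly's selection theorem yields a limit measure.
\<close>

section \<open>Minors and the Cauchy--Binet formula\<close>

lemma minor_cong:
  assumes "\<And>i j. i < m \<Longrightarrow> j < m \<Longrightarrow> A (r i) (c j) = A' (r' i) (c' j)"
  shows "minor A m r c = minor A' m r' c'"
  unfolding minor_def by (rule arg_cong[of _ _ Determinant.det]) (rule eq_matI, auto simp: assms)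

lemma minor_expand:
  "minor A m r c = (\<Sum>p | p permutes {0..<m}. signof p * (\<Prod>i=0..<m. A (r i) (c (p i))))"
proof -
  have "minor A m r c = (\<Sum>p | p permutes {0..<m}. signof p *
      (\<Prod>i=0..<m. (Matrix.mat m m (\<lambda>(i, j). A (r i) (c j))) $$ (i, p i)))"
    unfolding minor_def by (rule det_def') simp
  also have "\<dots> = (\<Sum>p | p permutes {0..<m}. signof p * (\<Prod>i=0..<m. A (r i) (c (p i))))"
    by (intro sum.cong refl arg_cong2[of _ _ _ _ "(*)"] prod.cong) (auto simp: permutes_nat_less)
  finally show ?thesis .
qed

lemma minor_transpose: "minor (\<lambda>i j. A j i) m r c = minor A m c r"
proof -
  let ?M = "Matrix.mat m m (\<lambda>(i, j). A (c i) (r j))"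
  have "Matrix.mat m m (\<lambda>(i, j). A (c j) (r i)) = transpose_mat ?M"
    by (rule eq_matI) auto
  then show ?thesis
    unfolding minor_def using det_transpose[of ?M m] by simp
qed

lemma minor_single_row:
  assumes "i \<le> n" "j \<le> n" and 0: "\<And>j'. j' \<le> n \<Longrightarrow> j' \<noteq> j \<Longrightarrow> A (r i) (c j') = 0"
  shows "minor A (Suc n) r c =
    (-1) ^ (i + j) * A (r i) (c j) * minor A n (r \<circ> insert_index i) (c \<circ> insert_index j)"
proof -
  let ?M = "Matrix.mat (Suc n) (Suc n) (\<lambda>(i, j). A (r i) (c j))"
  have "minor A (Suc n) r c = (\<Sum>j'<Suc n. ?M $$ (i, j') * cofactor ?M i j')"
    unfolding minor_def by (rule laplace_expansion_row) (use assms in auto)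
  also have "\<dots> = (\<Sum>j'\<in>{j}. ?M $$ (i, j') * cofactor ?M i j')"
    by (rule sum.mono_neutral_right) (use assms in auto)
  also have "\<dots> = A (r i) (c j) * cofactor ?M i j"
    using assms by simp
  also have "mat_delete ?M i j =
      Matrix.mat n n (\<lambda>(i', j'). A ((r \<circ> insert_index i) i') ((c \<circ> insert_index j) j'))"
    by (rule eq_matI) (auto simp: mat_delete_def insert_index_def)
  then have "cofactor ?M i j =
      (-1) ^ (i + j) * minor A n (r \<circ> insert_index i) (c \<circ> insert_index j)"
    unfolding cofactor_def minor_def by simp
  finally show ?thesis by (simp add: ac_simps)
qed

lemma minor_single_col:
  assumes "i \<le> n" "j \<le> n" and "\<And>i'. i' \<le> n \<Longrightarrow> i' \<noteq> i \<Longrightarrow> A (r i') (c j) = 0"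
  shows "minor A (Suc n) r c =
    (-1) ^ (i + j) * A (r i) (c j) * minor A n (r \<circ> insert_index i) (c \<circ> insert_index j)"
  using minor_single_row[of j n i "\<lambda>i j. A j i" c r] assms
  by (simp add: minor_transpose[of A] add.commute)

lemma minor_insert_last:
  "minor A n (r \<circ> insert_index n) (c \<circ> insert_index n) = minor A n r c"
  by (rule minor_cong) simp

lemma minor_last_row:
  assumes "\<And>j. j < n \<Longrightarrow> A (r n) (c j) = 0"
  shows "minor A (Suc n) r c = A (r n) (c n) * minor A n r c"
  using minor_single_row[of n n n A r c] assms minor_insert_last[of A n r c] by simp

lemma minor_last_col:
  assumes "\<And>i. i < n \<Longrightarrow> A (r i) (c n) = 0"
  shows "minor A (Suc n) r c = A (r n) (c n) * minor A n r c"
  using minor_single_col[of n n n A r c] assms minor_insert_last[of A n r c] by simp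

lemma minor_first_row:
  assumes "\<And>j. 0 < j \<Longrightarrow> j \<le> n \<Longrightarrow> A (r 0) (c j) = 0"
  shows "minor A (Suc n) r c = A (r 0) (c 0) * minor A n (\<lambda>i. r (Suc i)) (\<lambda>j. c (Suc j))"
proof -
  have "insert_index 0 = Suc"
    by (auto simp: insert_index_def)
  then show ?thesis
    using minor_single_row[of 0 n 0 A r c] assms by (simp add: comp_def)
qed

lemma minor_0 [simp]: "minor A 0 r c = 1"
  by (simp add: minor_def)

lemma minor_zero_col:
  assumes "j < m" "\<And>i. i < m \<Longrightarrow> A (r i) (c j) = 0"
  shows "minor A m r c = 0"
proof (cases m)
  case (Suc n)
  then show ?thesis
    using minor_single_col[of 0 n j A r c] assms by simp
qed (use assms in simp)

text \<open>Represents an index set by its increasing enumeration, the form in which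
  \<open>minor\<close> takes rows and columns. Values at \<open>i\<close> \<ge>
  \<open>card S\<close> are junk.\<close>

definition index_enum :: "nat set \<Rightarrow> nat \<Rightarrow> nat" where
  "index_enum S i = sorted_list_of_set S ! i"

lemma index_enum:
  assumes "finite S" "card S = m"
  shows "strict_mono_on {..<m} (index_enum S)" "bij_betw (index_enum S) {..<m} S"
proof -
  show "strict_mono_on {..<m} (index_enum S)"
    unfolding index_enum_def strict_mono_on_def
    using assms sorted_list_of_set.strict_sorted_key_list_of_set[of S] sorted_wrt_nth_less
    by (metis lessThan_iff sorted_list_of_set.length_sorted_key_list_of_set)
  show "bij_betw (index_enum S) {..<m} S"
    unfolding index_enum_def using assms
    by (intro bij_betw_nth) auto
qed

text \<open>An injection onto \<open>S\<close> is a permutation followed by the increasing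
  enumeration of \<open>S\<close>. Reordering the rows of the minor of \<open>B\<close> contributes
  the sign, and the signed products add up to the minor of \<open>A\<close>.\<close>

lemma sum_prod_minor_eq:
  assumes S: "finite S" "card S = m" and N: "S \<subseteq> {..<N}"
  shows "(\<Sum>f | f \<in> {0..<m} \<rightarrow>\<^sub>E {..<N} \<and> inj_on f {0..<m} \<and> f ` {0..<m} = S.
            (\<Prod>i=0..<m. A (r i) (f i)) * minor B m f c)
    = minor A m r (index_enum S) * minor B m (index_enum S) c"
proof -
  let ?g = "index_enum S"
  let ?F = "\<lambda>p. restrict (\<lambda>i. ?g (p i)) {0..<m}"
  have g: "bij_betw ?g {0..<m} S"
    using index_enum(2)[OF S] by (simp add: atLeast0LessThan)
  have bij: "bij_betw ?F {p. p permutes {0..<m}}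
      {f. f \<in> {0..<m} \<rightarrow>\<^sub>E {..<N} \<and> inj_on f {0..<m} \<and> f ` {0..<m} = S}"
    unfolding bij_betw_def
  proof (intro conjI equalityI subsetI)
    show "inj_on ?F {p. p permutes {0..<m}}"
    proof (rule inj_onI, rule ext)
      fix p p' i
      assume p: "p \<in> {p. p permutes {0..<m}}" "p' \<in> {p. p permutes {0..<m}}" "?F p = ?F p'"
      show "p i = p' i"
      proof (cases "i \<in> {0..<m}")
        case True
        then have "?g (p i) = ?g (p' i)"
          using p(3) by (metis (no_types, lifting) restrict_apply')
        then show ?thesis
          using True p g by (auto simp: bij_betw_def inj_on_def permutes_nat_less)
      next
        case False
        then show ?thesis using p by (auto simp: permutes_def)
      qed
    qed
  next
    fix f assume "f \<in> ?F ` {p. p permutes {0..<m}}"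
    then obtain p where p: "p permutes {0..<m}" "f = ?F p" by auto
    have b: "bij_betw (?g \<circ> p) {0..<m} S"
      using bij_betw_trans[OF permutes_imp_bij[OF p(1)] g] .
    have "bij_betw f {0..<m} S"
      using b by (rule bij_betw_cong[THEN iffD1, rotated]) (simp add: p(2))
    then show "f \<in> {f. f \<in> {0..<m} \<rightarrow>\<^sub>E {..<N} \<and> inj_on f {0..<m} \<and> f ` {0..<m} = S}"
      using N by (auto simp: bij_betw_def p(2))
  next
    fix f assume "f \<in> {f. f \<in> {0..<m} \<rightarrow>\<^sub>E {..<N} \<and> inj_on f {0..<m} \<and> f ` {0..<m} = S}"
    then have f: "f \<in> {0..<m} \<rightarrow>\<^sub>E {..<N}" "bij_betw f {0..<m} S"
      by (auto simp: bij_betw_def)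
    define p where "p i = (if i \<in> {0..<m} then the_inv_into {0..<m} ?g (f i) else i)" for i
    have "bij_betw (the_inv_into {0..<m} ?g \<circ> f) {0..<m} {0..<m}"
      using bij_betw_trans[OF f(2) bij_betw_the_inv_into[OF g]] .
    then have "bij_betw p {0..<m} {0..<m}"
      by (rule bij_betw_cong[THEN iffD1, rotated]) (simp add: p_def)
    then have perm: "p permutes {0..<m}"
      by (rule bij_imp_permutes) (simp add: p_def)
    have "f = ?F p"
    proof (rule ext)
      fix i show "f i = ?F p i"
      proof (cases "i \<in> {0..<m}")
        case True
        then have "f i \<in> S" using f(2) by (auto simp: bij_betw_def)
        then show ?thesis using True g
          by (simp add: p_def f_the_inv_into_f_bij_betw)
      qed (use f(1) in \<open>auto simp: PiE_def extensional_def\<close>)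
    qed
    with perm show "f \<in> ?F ` {p. p permutes {0..<m}}" by auto
  qed
  have "(\<Sum>f | f \<in> {0..<m} \<rightarrow>\<^sub>E {..<N} \<and> inj_on f {0..<m} \<and> f ` {0..<m} = S.
            (\<Prod>i=0..<m. A (r i) (f i)) * minor B m f c)
      = (\<Sum>p | p permutes {0..<m}. (\<Prod>i=0..<m. A (r i) (?F p i)) * minor B m (?F p) c)"
    by (rule sum.reindex_bij_betw[OF bij, symmetric])
  also have "\<dots> = (\<Sum>p | p permutes {0..<m}.
      signof p * (\<Prod>i=0..<m. A (r i) (?g (p i))) * minor B m ?g c)"
  proof (rule sum.cong[OF refl])
    fix p assume "p \<in> {p. p permutes {0..<m}}"
    then have p: "p permutes {0..<m}" by simp
    let ?M = "Matrix.mat m m (\<lambda>(i, j). B (?g i) (c j))"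
    have "minor B m (?F p) c = Determinant.det (Matrix.mat m m (\<lambda>(i, j). ?M $$ (p i, j)))"
      unfolding minor_def
      by (rule arg_cong[of _ _ Determinant.det]) (rule eq_matI, use p in \<open>auto simp: permutes_nat_less\<close>)
    also have "\<dots> = signof p * minor B m ?g c"
      unfolding minor_def by (rule det_permute_rows[OF _ p]) simp
    finally show "(\<Prod>i=0..<m. A (r i) (?F p i)) * minor B m (?F p) c =
        signof p * (\<Prod>i=0..<m. A (r i) (?g (p i))) * minor B m ?g c"
      by (simp add: ac_simps)
  qed
  also have "\<dots> = minor A m r ?g * minor B m ?g c"
    by (simp add: minor_expand[of A] sum_distrib_right)
  finally show ?thesis .
qed

text \<open>Expanding the products of row sums gives a sum over all maps \<open>f\<close> from row
  positions to inner indices. Noninjective maps give a minor of \<open>B\<close> with two equal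
  rows; the others are grouped by their image.\<close>

theorem Cauchy_Binet:
  "minor (\<lambda>i k. \<Sum>j<N. A i j * B j k) m r c =
    (\<Sum>S | S \<subseteq> {..<N} \<and> card S = m. minor A m r (index_enum S) * minor B m (index_enum S) c)"
proof -
  let ?P = "{0..<m} \<rightarrow>\<^sub>E {..<N}"
  let ?t = "\<lambda>f. (\<Prod>i=0..<m. A (r i) (f i)) * minor B m f c"
  have fin: "finite ?P" by (intro finite_PiE) auto
  have "minor (\<lambda>i k. \<Sum>j<N. A i j * B j k) m r c =
     (\<Sum>p | p permutes {0..<m}. \<Sum>f\<in>?P. signof p *
        ((\<Prod>i=0..<m. A (r i) (f i)) * (\<Prod>i=0..<m. B (f i) (c (p i)))))"
    unfolding minor_expand
    by (subst prod_sum_PiE) (auto simp: sum_distrib_left prod.distrib)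
  also have "\<dots> = (\<Sum>f\<in>?P. ?t f)"
    by (subst sum.swap) (auto simp: minor_expand sum_distrib_left ac_simps intro!: sum.cong)
  also have "\<dots> = (\<Sum>f | f \<in> ?P \<and> inj_on f {0..<m}. ?t f)"
  proof (rule sum.mono_neutral_right[OF fin], goal_cases)
    case 2
    show ?case
    proof
      fix f assume f: "f \<in> ?P - {f \<in> ?P. inj_on f {0..<m}}"
      then obtain i j where ij: "i < m" "j < m" "i \<noteq> j" "f i = f j"
        by (auto simp: inj_on_def)
      have "minor B m f c = 0"
        unfolding minor_def
        by (rule det_identical_rows[OF _ ij(3) ij(1,2)]) (use ij in \<open>auto intro!: eq_vecI\<close>)
      then show "?t f = 0" by simp
    qed
  qed auto
  also have "\<dots> = (\<Sum>S | S \<subseteq> {..<N} \<and> card S = m.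
      \<Sum>f\<in>{f \<in> {f. f \<in> ?P \<and> inj_on f {0..<m}}. f ` {0..<m} = S}. ?t f)"
  proof (rule sum.group[symmetric])
    show "finite {f. f \<in> ?P \<and> inj_on f {0..<m}}"
      using fin by (rule finite_subset[rotated]) auto
    show "(\<lambda>f. f ` {0..<m}) ` {f. f \<in> ?P \<and> inj_on f {0..<m}} \<subseteq> {S. S \<subseteq> {..<N} \<and> card S = m}"
      by (auto simp: card_image)
  qed simp
  also have "\<dots> = (\<Sum>S | S \<subseteq> {..<N} \<and> card S = m.
      minor A m r (index_enum S) * minor B m (index_enum S) c)"
  proof (rule sum.cong[OF refl])
    fix S assume "S \<in> {S. S \<subseteq> {..<N} \<and> card S = m}"
    then have S: "finite S" "card S = m" "S \<subseteq> {..<N}"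
      by (auto intro: finite_subset)
    show "(\<Sum>f\<in>{f \<in> {f. f \<in> ?P \<and> inj_on f {0..<m}}. f ` {0..<m} = S}. ?t f)
        = minor A m r (index_enum S) * minor B m (index_enum S) c"
      using sum_prod_minor_eq[OF S, of A r B c] by (simp add: conj_assoc)
  qed
  finally show ?thesis .
qed

section \<open>Total positivity over a positive cone\<close>

text \<open>Isolates what the argument uses of nonnegativity, so that it serves both polynomials
  with nonnegative coefficients and nonnegative reals.\<close>

locale positive_cone =
  fixes C :: "'a::comm_ring_1 set"
  assumes zero_mem [simp]: "0 \<in> C" and one_mem [simp]: "1 \<in> C"
    and add_mem: "x \<in> C \<Longrightarrow> y \<in> C \<Longrightarrow> x + y \<in> C"
    and mult_mem: "x \<in> C \<Longrightarrow> y \<in> C \<Longrightarrow> x * y \<in> C"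
begin

lemma sum_mem: "(\<And>i. i \<in> S \<Longrightarrow> f i \<in> C) \<Longrightarrow> sum f S \<in> C"
  by (induction S rule: infinite_finite_induct) (auto intro: add_mem)

lemma of_nat_mem: "of_nat n \<in> C"
  by (induction n) (auto intro: add_mem)

definition TP :: "(nat \<Rightarrow> nat \<Rightarrow> 'a) \<Rightarrow> bool" where
  "TP A \<longleftrightarrow> (\<forall>m r c. strict_mono_on {..<m} r \<and> strict_mono_on {..<m} c \<longrightarrow> minor A m r c \<in> C)"

lemma TPI:
  "(\<And>m r c. strict_mono_on {..<m} r \<Longrightarrow> strict_mono_on {..<m} c \<Longrightarrow> minor A m r c \<in> C) \<Longrightarrow> TP A"
  by (auto simp: TP_def)

lemma TPD:
  "TP A \<Longrightarrow> strict_mono_on {..<m} r \<Longrightarrow> strict_mono_on {..<m} c \<Longrightarrow> minor A m r c \<in> C"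
  by (auto simp: TP_def)

lemma TP_transpose: "TP A \<Longrightarrow> TP (\<lambda>i j. A j i)"
  by (auto simp: TP_def minor_transpose[of A])

text \<open>The bound \<open>h\<close> on the row supports lets a given minor involve only finitely
  many inner indices, so that Cauchy--Binet applies.\<close>

lemma TP_mult:
  assumes A: "TP A" and B: "TP B" and h: "\<And>n j. h n \<le> j \<Longrightarrow> A n j = 0"
  shows "TP (\<lambda>n k. \<Sum>j<h n. A n j * B j k)"
proof (rule TPI)
  fix m :: nat and r c :: "nat \<Rightarrow> nat"
  assume r: "strict_mono_on {..<m} r" and c: "strict_mono_on {..<m} c"
  define N where "N = Max (h ` r ` {..<m})"
  have N: "h (r i) \<le> N" if "i < m" for i
    unfolding N_def by (rule Max_ge) (use that in auto)
  have "minor (\<lambda>n k. \<Sum>j<h n. A n j * B j k) m r c = minor (\<lambda>n k. \<Sum>j<N. A n j * B j k) m r c"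
    by (intro minor_cong sum.mono_neutral_left) (use N in \<open>auto simp: h intro: less_le_trans\<close>)
  also have "\<dots> \<in> C"
    unfolding Cauchy_Binet
    by (intro sum_mem mult_mem TPD[OF A] TPD[OF B] r c index_enum) (auto intro: finite_subset)
  finally show "minor (\<lambda>n k. \<Sum>j<h n. A n j * B j k) m r c \<in> C" .
qed

text \<open>In the minor, either the last row or the last column has at most one nonzero entry.\<close>

lemma TP_staircase:
  assumes mem: "\<And>k j. A k j \<in> C" and f: "mono f"
    and 0: "\<And>k j. j < f k \<or> f (Suc k) < j \<Longrightarrow> A k j = 0"
  shows "TP A"
proof (rule TPI)
  fix m :: nat and r c :: "nat \<Rightarrow> nat"
  assume "strict_mono_on {..<m} r" "strict_mono_on {..<m} c"
  then show "minor A m r c \<in> C"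
  proof (induction m)
    case (Suc n)
    have r: "r i < r n" and c: "c i < c n" if "i < n" for i
      using Suc.prems that by (auto simp: strict_mono_on_def)
    have IH: "minor A n r c \<in> C"
      using Suc.prems by (intro Suc.IH) (auto simp: strict_mono_on_def)
    have "minor A (Suc n) r c = A (r n) (c n) * minor A n r c"
    \<comment> \<open>An earlier row ends by column \<open>f (Suc (r i))\<close> \<le>
      \<open>f (r n)\<close>. So in the first case the last column is zero above its last entry; in
      the second the last row is zero left of its last entry.\<close>
    proof (cases "f (r n) < c n")
      case True
      have "A (r i) (c n) = 0" if "i < n" for i
      proof -
        have "f (Suc (r i)) \<le> f (r n)"
          using monoD[OF f, of "Suc (r i)" "r n"] r[OF that] by simp
        then show ?thesis using True by (intro 0) auto
      qed
      then show ?thesis by (rule minor_last_col)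
    next
      case False
      then have "A (r n) (c j) = 0" if "j < n" for j
        using c[OF that] by (intro 0) auto
      then show ?thesis by (rule minor_last_row)
    qed
    then show ?case using IH mem by (simp add: mult_mem)
  qed simp
qed

text \<open>A minor avoiding row \<open>0\<close> is a minor of \<open>Q\<close>. In any other, the
  unit row has at most its first entry nonzero, and expanding along it leaves a minor of the first
  kind.\<close>

lemma TP_cons_row:
  assumes Q: "TP Q"
  shows "TP (\<lambda>n k. case n of 0 \<Rightarrow> (if k = 0 then 1 else 0) | Suc n' \<Rightarrow> Q n' k)" (is "TP ?A")
proof (rule TPI)
  fix m :: nat and r c :: "nat \<Rightarrow> nat"
  assume r: "strict_mono_on {..<m} r" and c: "strict_mono_on {..<m} c"
  have pos: "minor ?A l r' c' \<in> C"
    if "strict_mono_on {..<l} r'" "strict_mono_on {..<l} c'" "\<And>i. i < l \<Longrightarrow> 0 < r' i" for l r' c'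
  proof -
    have "minor ?A l r' c' = minor Q l (\<lambda>i. r' i - 1) c'"
      by (rule minor_cong) (auto split: nat.split dest: that(3))
    also have "\<dots> \<in> C"
      by (intro TPD[OF Q] strict_mono_onI that(2) diff_less_mono)
        (use that in \<open>auto simp: strict_mono_on_def Suc_le_eq\<close>)
    finally show ?thesis .
  qed
  show "minor ?A m r c \<in> C"
  proof (cases m)
    case (Suc n)
    have rS: "0 < r (Suc i)" and cS: "0 < c (Suc i)" if "i < n" for i
      using strict_mono_onD[OF r, of 0 "Suc i"] strict_mono_onD[OF c, of 0 "Suc i"] that Suc by auto
    show ?thesis
    proof (cases "r 0 = 0")
      case True
      have "?A (r 0) (c j) = 0" if "0 < j" "j \<le> n" for j
        using True cS[of "j - 1"] that by simp
      then have "minor ?A m r c = ?A (r 0) (c 0) * minor ?A n (\<lambda>i. r (Suc i)) (\<lambda>j. c (Suc j))"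
        unfolding Suc by (rule minor_first_row)
      also have "\<dots> \<in> C"
        using True rS r c Suc by (intro mult_mem pos) (auto simp: strict_mono_on_def)
      finally show ?thesis .
    next
      case False
      have "0 < r i" if "i < m" for i
        using False rS[of "i - 1"] that Suc by (cases i) auto
      then show ?thesis using r c by (intro pos)
    qed
  qed simp
qed

lemma TP_cons_zero_col:
  assumes A: "TP A"
  shows "TP (\<lambda>n k. case k of 0 \<Rightarrow> 0 | Suc k' \<Rightarrow> A n k')" (is "TP ?A")
proof (rule TPI)
  fix m :: nat and r c :: "nat \<Rightarrow> nat"
  assume r: "strict_mono_on {..<m} r" and c: "strict_mono_on {..<m} c"
  show "minor ?A m r c \<in> C"
  proof (cases "\<exists>j<m. c j = 0")
    case True
    then obtain j where "j < m" "c j = 0" by auto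
    then have "minor ?A m r c = 0" by (intro minor_zero_col[of j]) auto
    then show ?thesis by simp
  next
    case False
    have "minor ?A m r c = minor A m r (\<lambda>j. c j - 1)"
      by (rule minor_cong) (use False in \<open>auto split: nat.split\<close>)
    also have "\<dots> \<in> C"
      by (intro TPD[OF A] r strict_mono_onI diff_less_mono)
        (use False c in \<open>auto simp: strict_mono_on_def Suc_le_eq\<close>)
    finally show ?thesis .
  qed
qed

end

section \<open>Matrices generated by a production matrix, and Hankel matrices of their zeroth
  column\<close>

text \<open>The parameter \<open>w\<close> bounds the band of \<open>Q\<close> above the diagonal, so that row \<open>n\<close> vanishes beyond
  column \<open>n * w\<close> and the sum exhausts the matrix product.\<close>

primrec output_mat :: "nat \<Rightarrow> (nat \<Rightarrow> nat \<Rightarrow> 'a::comm_ring_1) \<Rightarrow> nat \<Rightarrow> nat \<Rightarrow> 'a" where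
  "output_mat w Q 0 = (\<lambda>k. if k = 0 then 1 else 0)"
| "output_mat w Q (Suc n) = (\<lambda>k. \<Sum>j\<le>n * w. output_mat w Q n j * Q j k)"

lemma output_mat_eq_0:
  assumes "\<And>n k. n + w < k \<Longrightarrow> Q n k = 0" "n * w < k"
  shows "output_mat w Q n k = 0"
  using assms(2)
proof (induction n arbitrary: k)
  case (Suc n)
  have "Q j k = 0" if "j \<le> n * w" for j
    using Suc.prems that by (intro assms(1)) simp
  then show ?case by simp
qed simp

text \<open>If \<open>O\<^sub>N\<close> consists of the first \<open>N\<close> rows, then \<open>O\<^sub>N\<^sub>+\<^sub>1\<close> is the product of \<open>1 \<oplus> O\<^sub>N\<close> with \<open>Q\<close>
  preceded by the row \<open>(1, 0, 0, \<dots>)\<close>.\<close>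

lemma (in positive_cone) TP_output_mat:
  assumes Q: "TP Q" and w: "\<And>n k. n + w < k \<Longrightarrow> Q n k = 0"
  shows "TP (output_mat w Q)"
proof -
  let ?O = "\<lambda>N n k. if n < N then output_mat w Q n k else 0"
  have trunc: "TP (?O N)" for N
  proof (induction N)
    case 0
    show ?case by (rule TP_staircase[where f = "\<lambda>_. 0"]) (auto simp: mono_def)
  next
    case (Suc N)
    let ?A = "\<lambda>n k. case n of 0 \<Rightarrow> (if k = 0 then 1 else 0)
       | Suc n' \<Rightarrow> (case k of 0 \<Rightarrow> 0 | Suc k' \<Rightarrow> ?O N n' k')"
    let ?B = "\<lambda>n k. case n of 0 \<Rightarrow> (if k = 0 then 1 else 0) | Suc n' \<Rightarrow> Q n' k"
    have "TP (\<lambda>n k. \<Sum>j<Suc (Suc (n * w)). ?A n j * ?B j k)"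
    proof (rule TP_mult)
      show "TP ?A" by (intro TP_cons_row TP_cons_zero_col Suc.IH)
      show "TP ?B" by (intro TP_cons_row Q)
      fix n j assume "Suc (Suc (n * w)) \<le> j"
      then show "?A n j = 0"
        by (auto split: nat.split intro!: output_mat_eq_0 w)
    qed
    also have "(\<lambda>n k. \<Sum>j<Suc (Suc (n * w)). ?A n j * ?B j k) = ?O (Suc N)"
    proof (intro ext)
      fix n k
      show "(\<Sum>j<Suc (Suc (n * w)). ?A n j * ?B j k) = ?O (Suc N) n k"
      proof (cases n)
        case 0
        then show ?thesis by (simp add: lessThan_Suc)
      next
        case (Suc n')
        have "(\<Sum>j<Suc (Suc (n * w)). ?A n j * ?B j k) = (\<Sum>j<Suc (n * w). ?O N n' j * Q j k)"
          by (subst sum.lessThan_Suc_shift) (simp add: Suc del: sum.lessThan_Suc)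
        also have "\<dots> = (\<Sum>j\<le>n' * w. ?O N n' j * Q j k)"
          by (rule sum.mono_neutral_right) (auto simp: Suc output_mat_eq_0[where Q = Q, OF w])
        finally show ?thesis using Suc by simp
      qed
    qed
    finally show ?case .
  qed
  show ?thesis
  proof (rule TPI)
    fix m :: nat and r c :: "nat \<Rightarrow> nat"
    assume r: "strict_mono_on {..<m} r" and c: "strict_mono_on {..<m} c"
    define N where "N = Suc (Max (r ` {..<m}))"
    have N: "r i < N" if "i < m" for i
      unfolding N_def less_Suc_eq_le by (rule Max_ge) (use that in auto)
    have "minor (output_mat w Q) m r c = minor (?O N) m r c"
      by (rule minor_cong) (use N in auto)
    then show "minor (output_mat w Q) m r c \<in> C"
      using TPD[OF trunc r c] by simp
  qed
qed

text \<open>\<open>output_mat w Q i\<close> is row \<open>0\<close> of the \<open>i\<close>-th power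
  of \<open>Q\<close>, and its transposed analogue is column \<open>0\<close> of the
  \<open>j\<close>-th power; their product is entry \<open>(0, 0)\<close> of the power
  \<open>i + j\<close>. The induction moves one factor \<open>Q\<close> across.\<close>

lemma output_mat_hankel:
  assumes upper: "\<And>n k. n + w < k \<Longrightarrow> Q n k = 0" and lower: "\<And>n k. k + w' < n \<Longrightarrow> Q n k = 0"
  shows "output_mat w Q (i + j) 0 =
    (\<Sum>k\<le>i * w. output_mat w Q i k * output_mat w' (\<lambda>n k. Q k n) j k)"
proof (induction j arbitrary: i)
  case 0
  have "(\<Sum>k\<le>i * w. output_mat w Q i k * output_mat w' (\<lambda>n k. Q k n) 0 k)
      = (\<Sum>k\<in>{0}. output_mat w Q i k * output_mat w' (\<lambda>n k. Q k n) 0 k)"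
    by (rule sum.mono_neutral_right) auto
  then show ?case by simp
next
  case (Suc j)
  let ?U = "output_mat w Q" and ?V = "output_mat w' (\<lambda>n k. Q k n)"
  \<comment> \<open>The range can be enlarged by the upper band of \<open>Q\<close> and then cut
    down because \<open>?V j\<close> vanishes beyond \<open>j * w'\<close>.\<close>
  have V: "(\<Sum>k\<le>Suc i * w. Q l k * ?V j k) = ?V (Suc j) l" if "l \<le> i * w" for l
  proof -
    have "(\<Sum>k\<le>Suc i * w. Q l k * ?V j k) = (\<Sum>k\<le>Suc i * w + j * w'. Q l k * ?V j k)"
      by (rule sum.mono_neutral_left) (use that in \<open>auto simp: upper\<close>)
    also have "\<dots> = (\<Sum>k\<le>j * w'. Q l k * ?V j k)"
      by (rule sum.mono_neutral_right) (auto simp: output_mat_eq_0[where w = w', OF lower])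
    finally show ?thesis by (simp add: mult.commute)
  qed
  have "?U (i + Suc j) 0 = ?U (Suc i + j) 0" by simp
  also have "\<dots> = (\<Sum>k\<le>Suc i * w. ?U (Suc i) k * ?V j k)"
    by (rule Suc.IH)
  also have "\<dots> = (\<Sum>k\<le>Suc i * w. \<Sum>l\<le>i * w. ?U i l * (Q l k * ?V j k))"
    by (simp add: sum_distrib_right mult.assoc)
  also have "\<dots> = (\<Sum>l\<le>i * w. ?U i l * (\<Sum>k\<le>Suc i * w. Q l k * ?V j k))"
    by (subst sum.swap) (simp add: sum_distrib_left)
  also have "\<dots> = (\<Sum>l\<le>i * w. ?U i l * ?V (Suc j) l)"
    by (intro sum.cong refl arg_cong2[of _ _ _ _ "(*)"] V) simp
  finally show ?case .
qed

text \<open>By \<open>output_mat_hankel\<close> the Hankel matrix is a product of two matrices that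
  are totally positive by \<open>TP_output_mat\<close>, applied to \<open>Q\<close> and to its
  transpose.\<close>

lemma (in positive_cone) TP_hankel_output_mat:
  assumes Q: "TP Q" and upper: "\<And>n k. n + w < k \<Longrightarrow> Q n k = 0"
    and lower: "\<And>n k. k + w' < n \<Longrightarrow> Q n k = 0"
  shows "TP (hankel (\<lambda>n. output_mat w Q n 0))"
proof -
  let ?V = "output_mat w' (\<lambda>n k. Q k n)"
  have "TP (\<lambda>i j. \<Sum>k<Suc (i * w). output_mat w Q i k * ?V j k)"
  proof (rule TP_mult)
    show "TP (output_mat w Q)" using Q upper by (rule TP_output_mat)
    have "TP ?V" using TP_transpose[OF Q] lower by (rule TP_output_mat)
    then show "TP (\<lambda>k j. ?V j k)" by (rule TP_transpose)
  qed (auto intro!: output_mat_eq_0 upper)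
  also have "(\<lambda>i j. \<Sum>k<Suc (i * w). output_mat w Q i k * ?V j k) =
      hankel (\<lambda>n. output_mat w Q n 0)"
    by (intro ext) (simp add: hankel_def output_mat_hankel[where w = w and Q = Q, OF upper lower] lessThan_Suc_atMost
        del: sum.lessThan_Suc)
  finally show ?thesis .
qed

section \<open>Iterated log-convexity\<close>

text \<open>Expansion along the first row, with the deleted column moved into the index function so
  that small minors unfold to explicit polynomials.\<close>

lemma minor_Suc:
  "minor A (Suc n) r c = (\<Sum>j<Suc n. (-1) ^ j * A (r 0) (c j) *
      minor A n (\<lambda>i. r (Suc i)) (\<lambda>i. c (if i < j then i else Suc i)))"
proof -
  let ?M = "Matrix.mat (Suc n) (Suc n) (\<lambda>(i, j). A (r i) (c j))"
  have "minor A (Suc n) r c = (\<Sum>j<Suc n. ?M $$ (0, j) * cofactor ?M 0 j)"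
    unfolding minor_def by (rule laplace_expansion_row) auto
  also have "\<dots> = (\<Sum>j<Suc n. (-1) ^ j * A (r 0) (c j) *
      minor A n (\<lambda>i. r (Suc i)) (\<lambda>i. c (if i < j then i else Suc i)))"
  proof (rule sum.cong[OF refl])
    fix j assume j: "j \<in> {..<Suc n}"
    have "mat_delete ?M 0 j =
        Matrix.mat n n (\<lambda>(i', j'). A (r (Suc i')) (c (if j' < j then j' else Suc j')))"
      by (rule eq_matI) (auto simp: mat_delete_def)
    then show "?M $$ (0, j) * cofactor ?M 0 j = (-1) ^ j * A (r 0) (c j) *
        minor A n (\<lambda>i. r (Suc i)) (\<lambda>i. c (if i < j then i else Suc i))"
      using j unfolding cofactor_def minor_def by (simp add: ac_simps)
  qed
  finally show ?thesis .
qed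

lemma minor_1: "minor A (Suc 0) r c = A (r 0) (c 0)"
  by (simp add: minor_Suc)

lemma minor_2:
  "minor A (Suc (Suc 0)) r c = A (r 0) (c 0) * A (r 1) (c 1) - A (r 0) (c 1) * A (r 1) (c 0)"
  by (simp add: minor_Suc[of A "Suc 0"] minor_1)

lemma minor_3:
  "minor A (Suc (Suc (Suc 0))) r c =
     A (r 0) (c 0) * (A (r 1) (c 1) * A (r 2) (c 2) - A (r 1) (c 2) * A (r 2) (c 1))
     - A (r 0) (c 1) * (A (r 1) (c 0) * A (r 2) (c 2) - A (r 1) (c 2) * A (r 2) (c 0))
     + A (r 0) (c 2) * (A (r 1) (c 0) * A (r 2) (c 1) - A (r 1) (c 1) * A (r 2) (c 0))"
  by (simp add: minor_Suc[of A "Suc (Suc 0)"] minor_2 numeral_2_eq_2)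

lemma hankel_minor_2:
  "minor (hankel s) 2 (\<lambda>i. p + i) (\<lambda>j. j) = s p * s (p + 2) - (s (p + 1))\<^sup>2"
  by (simp add: minor_2 hankel_def power2_eq_square eval_nat_numeral)

lemma hankel_minor_3:
  "minor (hankel s) 3 (\<lambda>i. p + i) (\<lambda>j. j) =
     s p * (s (p + 2) * s (p + 4) - (s (p + 3))\<^sup>2)
     - s (p + 1) * (s (p + 1) * s (p + 4) - s (p + 2) * s (p + 3))
     + s (p + 2) * (s (p + 1) * s (p + 3) - (s (p + 2))\<^sup>2)"
  by (simp add: minor_3 hankel_def power2_eq_square eval_nat_numeral algebra_simps)

text \<open>Deleting the first or last column leaves a Hankel minor of size \<open>3\<close>; the
  two middle minors are not of this form and are written out.\<close>

lemma hankel_minor_4: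
  "minor (hankel s) 4 (\<lambda>i. p + i) (\<lambda>j. j) =
     s p * minor (hankel s) 3 (\<lambda>i. (p + 2) + i) (\<lambda>j. j)
     - s (p + 1) * (s (p + 1) * (s (p + 4) * s (p + 6) - (s (p + 5))\<^sup>2)
        - s (p + 3) * (s (p + 2) * s (p + 6) - s (p + 3) * s (p + 5))
        + s (p + 4) * (s (p + 2) * s (p + 5) - s (p + 3) * s (p + 4)))
     + s (p + 2) * (s (p + 1) * (s (p + 3) * s (p + 6) - s (p + 4) * s (p + 5))
        - s (p + 2) * (s (p + 2) * s (p + 6) - s (p + 3) * s (p + 5))
        + s (p + 4) * (s (p + 2) * s (p + 4) - (s (p + 3))\<^sup>2))
     - s (p + 3) * minor (hankel s) 3 (\<lambda>i. (p + 1) + i) (\<lambda>j. j)"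
  using minor_Suc[of "hankel s" "Suc (Suc (Suc 0))" "\<lambda>i. p + i" "\<lambda>j. j"]
  by (simp add: minor_3 hankel_def power2_eq_square eval_nat_numeral algebra_simps)

text \<open>Both identities are Dodgson condensation for a Hankel determinant.\<close>

lemma LC_LC_eq:
  "LC (LC s) (p + 2) = s (p + 2) * minor (hankel s) 3 (\<lambda>i. p + i) (\<lambda>j. j)"
  unfolding hankel_minor_3 by (simp add: LC_def power2_eq_square eval_nat_numeral algebra_simps)

lemma hankel_minor_3_log_convex:
  "minor (hankel s) 3 (\<lambda>i. p + i) (\<lambda>j. j) * minor (hankel s) 3 (\<lambda>i. (p + 2) + i) (\<lambda>j. j)
     - (minor (hankel s) 3 (\<lambda>i. (p + 1) + i) (\<lambda>j. j))\<^sup>2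
   = minor (hankel s) 4 (\<lambda>i. p + i) (\<lambda>j. j) * minor (hankel s) 2 (\<lambda>i. (p + 2) + i) (\<lambda>j. j)"
proof -
  define a0 a1 a2 a3 a4 a5 a6 where a: "a0 = s p" "a1 = s (p + 1)" "a2 = s (p + 2)"
    "a3 = s (p + 3)" "a4 = s (p + 4)" "a5 = s (p + 5)" "a6 = s (p + 6)"
  have n: "p + 1 + 1 = p + 2" "p + 1 + 2 = p + 3" "p + 1 + 3 = p + 4" "p + 1 + 4 = p + 5"
    "p + 2 + 1 = p + 3" "p + 2 + 2 = p + 4" "p + 2 + 3 = p + 5" "p + 2 + 4 = p + 6"
    by simp_all
  show ?thesis
    unfolding hankel_minor_4 hankel_minor_3 hankel_minor_2 n a[symmetric]
    by (simp only: power2_eq_square ring_distribs) (simp add: algebra_simps)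
qed

text \<open>The first iterate is a minor of size \<open>2\<close>, the second is \<open>s\<close>
  times a minor \<open>D\<close> of size \<open>3\<close>. For the third, log-convexity of this
  product splits into that of \<open>s\<close> and that of \<open>D\<close>, the latter by
  condensation to minors of sizes \<open>4\<close> and \<open>2\<close>.\<close>

lemma (in positive_cone) iterated_LC_mem:
  assumes s: "TP (hankel s)" and "k \<le> 3" "k \<le> i"
  shows "(LC ^^ k) s i \<in> C"
proof -
  have H: "minor (hankel s) m (\<lambda>i. p + i) (\<lambda>j. j) \<in> C" for m p
    by (intro TPD[OF s]) (auto simp: strict_mono_on_def)
  have s_mem: "s n \<in> C" for n
    using H[of 1 n] by (simp add: minor_1 hankel_def)
  consider "k = 0" | p where "k = 1" "i = p + 1" | p where "k = 2" "i = p + 2"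
    | p where "k = 3" "i = p + 3"
    using assms(2,3) by (metis (no_types) One_nat_def Suc_1 add.commute le_Suc_eq le_iff_add le_zero_eq numeral_3_eq_3)
  then show ?thesis
  proof cases
    case 1
    then show ?thesis using s_mem by simp
  next
    case (2 p)
    then show ?thesis using H[of 2 p] by (simp add: LC_def hankel_minor_2)
  next
    case (3 p)
    then show ?thesis
      using LC_LC_eq[of s p] s_mem H[of 3 p] by (simp add: numeral_2_eq_2 mult_mem)
  next
    case (4 p)
    define D where "D p = minor (hankel s) 3 (\<lambda>i. p + i) (\<lambda>j. j)" for p
    have L2: "LC (LC s) (p + 2) = s (p + 2) * D p" for p
      unfolding D_def by (rule LC_LC_eq)
    have D: "D p \<in> C" for p
      unfolding D_def by (rule H)
    have "(LC ^^ k) s i = LC (LC (LC s)) (p + 3)"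
      using 4 by (simp add: numeral_3_eq_3)
    also have "\<dots> = s (p + 2) * D p * (s (p + 4) * D (p + 2)) - (s (p + 3) * D (p + 1))\<^sup>2"
      using L2[of p] L2[of "p + 1"] L2[of "p + 2"] unfolding LC_def[of "LC (LC s)"]
      by (simp add: eval_nat_numeral)
    also have "\<dots> = s (p + 2) * s (p + 4) * (D p * D (p + 2) - (D (p + 1))\<^sup>2)
        + (s (p + 2) * s (p + 4) - (s (p + 3))\<^sup>2) * (D (p + 1))\<^sup>2"
      by (simp add: algebra_simps power2_eq_square)
    also have "D p * D (p + 2) - (D (p + 1))\<^sup>2 =
        minor (hankel s) 4 (\<lambda>i. p + i) (\<lambda>j. j) * minor (hankel s) 2 (\<lambda>i. (p + 2) + i) (\<lambda>j. j)"
      unfolding D_def by (rule hankel_minor_3_log_convex)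
    also have "s (p + 2) * s (p + 4) - (s (p + 3))\<^sup>2 = minor (hankel s) 2 (\<lambda>i. (p + 2) + i) (\<lambda>j. j)"
      unfolding hankel_minor_2 by (simp add: eval_nat_numeral)
    finally show ?thesis
      by (simp only: power2_eq_square) (intro add_mem mult_mem s_mem H D)
  qed
qed

section \<open>The matrix \<open>J\<close>\<close>

text \<open>Recursion matrix of \<open>J B\<^sub>q\<close>: the tridiagonal recursion matrix of \<open>J\<close> is a product of a lower and an
  upper bidiagonal matrix, and conjugating by \<open>B\<^sub>q\<close> turns these into \<open>conj_lower\<close> and
  \<open>conj_upper\<close>. The latter is (lower bidiagonal) \<open>\<cdot>\<close> (upper bidiagonal) \<open>+ y\<close>; interleaving the
  inner index of that product with the diagonal term \<open>y\<close> writes it as a product of two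
  staircase matrices.\<close>

definition conj_lower :: "'a::comm_ring_1 \<Rightarrow> 'a \<Rightarrow> 'a \<Rightarrow> 'a \<Rightarrow> nat \<Rightarrow> nat \<Rightarrow> 'a" where
  "conj_lower a b c q n k =
     (if k = n then a * of_nat n + b else if Suc k = n then (c + a * q) * of_nat n else 0)"

definition upper_left :: "'a::comm_ring_1 \<Rightarrow> 'a \<Rightarrow> 'a \<Rightarrow> 'a \<Rightarrow> 'a \<Rightarrow> nat \<Rightarrow> nat \<Rightarrow> 'a" where
  "upper_left u v x y q k i =
     (if Suc i = 2 * k then (x + u * q) * of_nat k else if i = 2 * k then y
      else if i = Suc (2 * k) then u * of_nat (Suc k) + v else 0)"

definition upper_right :: "'a::comm_ring_1 \<Rightarrow> nat \<Rightarrow> nat \<Rightarrow> 'a" where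
  "upper_right q i k =
     (if Suc i = 2 * k \<or> i = 2 * k then 1 else if i = Suc (2 * k) then q else 0)"

definition conj_upper :: "'a::comm_ring_1 \<Rightarrow> 'a \<Rightarrow> 'a \<Rightarrow> 'a \<Rightarrow> 'a \<Rightarrow> nat \<Rightarrow> nat \<Rightarrow> 'a" where
  "conj_upper u v x y q j k =
     (if k = Suc j then u * of_nat (Suc j) + v
      else if k = j then (x + u * q) * of_nat j + y + (u * of_nat (Suc j) + v) * q
      else if Suc k = j then (x + u * q) * of_nat j * q else 0)"

lemma conj_upper_eq:
  "conj_upper u v x y q j k = (\<Sum>i<Suc (Suc (2 * j)). upper_left u v x y q j i * upper_right q i k)"
\<comment> \<open>The case \<open>j = 0\<close> is separate because \<open>2 * j - 1\<close>
  truncates there; otherwise the row has three distinct positions that can be nonzero.\<close>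
proof (cases j)
  case 0
  then show ?thesis
    by (auto simp: conj_upper_def upper_left_def upper_right_def)
next
  case (Suc j')
  have "(\<Sum>i<Suc (Suc (2 * j)). upper_left u v x y q j i * upper_right q i k)
      = (\<Sum>i\<in>{2 * j - 1, 2 * j, Suc (2 * j)}. upper_left u v x y q j i * upper_right q i k)"
    by (rule sum.mono_neutral_right) (auto simp: upper_left_def Suc)
  also have "\<dots> = conj_upper u v x y q j k"
    by (auto simp: conj_upper_def upper_left_def upper_right_def Suc)
  finally show ?thesis by simp
qed

context positive_cone
begin

lemma TP_conj_lower:
  assumes "a \<in> C" "b \<in> C" "c \<in> C" "q \<in> C"
  shows "TP (conj_lower a b c q)"
  by (rule TP_staircase[where f = "\<lambda>k. k - 1"])
    (use assms in \<open>auto simp: conj_lower_def mono_def intro!: add_mem mult_mem of_nat_mem\<close>)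

text \<open>Row \<open>k\<close> of \<open>upper_left\<close> and column \<open>k\<close> of
  \<open>upper_right\<close> occupy positions \<open>2 * k - 1\<close> to \<open>2 * k + 1\<close>,
  so consecutive ones meet only at \<open>2 * k + 1\<close>.\<close>

lemma TP_conj_upper:
  assumes "u \<in> C" "v \<in> C" "x \<in> C" "y \<in> C" "q \<in> C"
  shows "TP (conj_upper u v x y q)"
proof -
  have "TP (upper_left u v x y q)"
    by (rule TP_staircase[where f = "\<lambda>k. 2 * k - 1"])
      (use assms in \<open>auto simp: upper_left_def mono_def simp del: of_nat_Suc
        intro!: add_mem mult_mem of_nat_mem\<close>)
  moreover have "TP (\<lambda>k i. upper_right q i k)"
    by (rule TP_staircase[where f = "\<lambda>k. 2 * k - 1"])
      (use assms in \<open>auto simp: upper_right_def mono_def\<close>)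
  then have "TP (upper_right q)"
    using TP_transpose[of "\<lambda>k i. upper_right q i k"] by simp
  ultimately have "TP (\<lambda>j k. \<Sum>i<Suc (Suc (2 * j)). upper_left u v x y q j i * upper_right q i k)"
    by (rule TP_mult) (auto simp: upper_left_def)
  then show ?thesis
    by (simp add: conj_upper_eq[abs_def])
qed

end

definition conj_production ::
  "'a::comm_ring_1 \<Rightarrow> 'a \<Rightarrow> 'a \<Rightarrow> 'a \<Rightarrow> 'a \<Rightarrow> 'a \<Rightarrow> 'a \<Rightarrow> 'a \<Rightarrow> nat \<Rightarrow> nat \<Rightarrow> 'a" where
  "conj_production a b c u v x y q n k =
     (\<Sum>j<Suc n. conj_lower a b c q n j * conj_upper u v x y q j k)"

lemma (in positive_cone) TP_conj_production:
  assumes "a \<in> C" "b \<in> C" "c \<in> C" "u \<in> C" "v \<in> C" "x \<in> C" "y \<in> C" "q \<in> C"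
  shows "TP (conj_production a b c u v x y q)"
  unfolding conj_production_def[abs_def]
  by (intro TP_mult TP_conj_lower TP_conj_upper assms) (auto simp: conj_lower_def)

text \<open>These bandwidths are the values of \<open>w\<close> and \<open>w'\<close> for this
  production matrix.\<close>

lemma conj_production_band:
  "n + 1 < k \<Longrightarrow> conj_production a b c u v x y q n k = 0"
  "k + 2 < n \<Longrightarrow> conj_production a b c u v x y q n k = 0"
  by (auto simp: conj_production_def conj_lower_def conj_upper_def intro!: sum.neutral)

section \<open>Intertwining of the binomial matrix with the recursion of \<open>Jmat\<close>\<close>

lemma binomial_mat_eq_0: "n < k \<Longrightarrow> binomial_mat q n k = 0"
  by (simp add: binomial_mat_def binomial_eq_0)

text \<open>Reduces a sum against a column of a banded matrix to its few entries, with no case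
  distinction on how their positions compare with \<open>m\<close>.\<close>

lemma sum_binomial_mat:
  assumes "finite S" "\<And>i. i \<notin> S \<Longrightarrow> g i = 0"
  shows "(\<Sum>i\<le>m. binomial_mat q m i * g i) = (\<Sum>i\<in>S. binomial_mat q m i * g i)"
proof -
  have "(\<Sum>i\<le>m. binomial_mat q m i * g i) = (\<Sum>i\<in>{..m} \<union> S. binomial_mat q m i * g i)"
    using assms by (intro sum.mono_neutral_left) (auto simp: binomial_mat_eq_0)
  also have "\<dots> = (\<Sum>i\<in>S. binomial_mat q m i * g i)"
    using assms by (intro sum.mono_neutral_right) auto
  finally show ?thesis .
qed

lemma binomial_mat_absorb:
  "of_nat (Suc j) * binomial_mat q (Suc m) (Suc j) = of_nat (Suc m) * binomial_mat q m j"
proof -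
  have "of_nat (Suc j) * (of_nat (Suc m choose Suc j) :: 'a) = of_nat (Suc m) * of_nat (m choose j)"
    unfolding of_nat_mult[symmetric] by (simp only: Suc_times_binomial)
  then show ?thesis
    by (simp add: binomial_mat_def mult.assoc[symmetric] del: of_nat_Suc)
qed

text \<open>Moves multiplication by the row index through \<open>binomial_mat q\<close>: on the
  column side it becomes a lower bidiagonal factor.\<close>

lemma binomial_mat_times_row:
  "of_nat m * binomial_mat q m j =
    of_nat j * binomial_mat q m j + q * of_nat (Suc j) * binomial_mat q m (Suc j)"
proof (cases "j < m")
  case True
  have "Suc j * (m choose Suc j) = (m - j) * (m choose j)"
    using binomial_absorb_comp[of m j] binomial_absorption[of j m] by simp
  then have "of_nat (Suc j) * (of_nat (m choose Suc j) :: 'a) = (of_nat m - of_nat j) * of_nat (m choose j)"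
    using True by (metis of_nat_diff of_nat_mult less_imp_le)
  moreover have "q ^ (m - j) = q * q ^ (m - Suc j)"
    using True by (metis Suc_diff_Suc power_Suc)
  ultimately have "q * of_nat (Suc j) * binomial_mat q m (Suc j) =
      (of_nat m - of_nat j) * of_nat (m choose j) * q ^ (m - j)"
    unfolding binomial_mat_def by (metis (no_types, lifting) mult.assoc mult.commute)
  then show ?thesis
    by (simp add: binomial_mat_def algebra_simps del: of_nat_Suc)
next
  case False
  then show ?thesis by (cases "j = m") (auto simp: binomial_mat_def binomial_eq_0)
qed

lemma binomial_mat_Suc_0: "binomial_mat q (Suc m) 0 = q * binomial_mat q m 0"
  by (simp add: binomial_mat_def)

lemma binomial_mat_Suc_Suc:
  "binomial_mat q (Suc m) (Suc k) = binomial_mat q m k + q * binomial_mat q m (Suc k)"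
proof (cases "k < m")
  case True
  then have "q ^ (m - k) = q * q ^ (m - Suc k)"
    by (metis Suc_diff_Suc power_Suc)
  then show ?thesis by (simp add: binomial_mat_def algebra_simps)
next
  case False
  then show ?thesis by (cases "k = m") (auto simp: binomial_mat_def binomial_eq_0)
qed

text \<open>Intertwines \<open>conj_lower\<close> with the lower factor of the recursion matrix of
  \<open>Jmat\<close>, whose row \<open>m\<close> has entries \<open>c * m\<close> and
  \<open>a * m + b\<close>.\<close>

lemma binomial_mat_conj_lower:
  "(\<Sum>i\<le>m. binomial_mat q m i * conj_lower a b c q i j) =
    (a * of_nat m + b) * binomial_mat q m j +
    (if m = 0 then 0 else c * of_nat m * binomial_mat q (m - 1) j)"
proof -
  let ?B = "binomial_mat q"
  have "(\<Sum>i\<le>m. ?B m i * conj_lower a b c q i j) =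
      (\<Sum>i\<in>{j, Suc j}. ?B m i * conj_lower a b c q i j)"
    by (rule sum_binomial_mat) (auto simp: conj_lower_def)
  also have "\<dots> = ?B m j * (a * of_nat j + b) + ?B m (Suc j) * ((c + a * q) * of_nat (Suc j))"
    by (simp add: conj_lower_def del: of_nat_Suc)
  also have "\<dots> = a * (of_nat j * ?B m j + q * of_nat (Suc j) * ?B m (Suc j)) + b * ?B m j
      + c * (of_nat (Suc j) * ?B m (Suc j))"
    by (simp only: algebra_simps)
  also have "\<dots> = a * (of_nat m * ?B m j) + b * ?B m j + c * (of_nat (Suc j) * ?B m (Suc j))"
    by (simp only: binomial_mat_times_row[symmetric])
  also have "of_nat (Suc j) * ?B m (Suc j) = (if m = 0 then 0 else of_nat m * ?B (m - 1) j)"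
  proof (cases m)
    case 0 then show ?thesis by (simp add: binomial_mat_eq_0)
  next
    case (Suc m') then show ?thesis using binomial_mat_absorb[of j q m'] by simp
  qed
  finally show ?thesis by (simp add: algebra_simps)
qed

text \<open>The same relation for the upper factor, with entries \<open>x * m + y\<close> and
  \<open>u * (m + 1) + v\<close> in row \<open>m\<close>; the latter multiplies row
  \<open>m + 1\<close> of \<open>binomial_mat q\<close>.\<close>

lemma binomial_mat_conj_upper:
  "(\<Sum>j\<le>m. binomial_mat q m j * conj_upper u v x y q j k) =
    (x * of_nat m + y) * binomial_mat q m k + (u * of_nat (Suc m) + v) * binomial_mat q (Suc m) k"
proof (cases k)
  case 0
  let ?B = "binomial_mat q m"
  have "(\<Sum>j\<le>m. ?B j * conj_upper u v x y q j k) = (\<Sum>j\<in>{0, 1}. ?B j * conj_upper u v x y q j k)"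
    by (rule sum_binomial_mat) (auto simp: conj_upper_def 0)
  also have "\<dots> = x * (q * ?B 1) + y * ?B 0 + u * q * (q * ?B 1) + (u + v) * q * ?B 0"
    by (simp add: conj_upper_def 0 algebra_simps)
  also have "q * ?B 1 = of_nat m * ?B 0"
    using binomial_mat_times_row[of m q 0] by simp
  finally show ?thesis
    by (simp add: 0 binomial_mat_Suc_0 algebra_simps)
next
  case (Suc k')
  let ?B = "binomial_mat q m"
  have e: "of_nat m * ?B k' = of_nat k' * ?B k' + q * of_nat k * ?B k"
    "of_nat m * ?B k = of_nat k * ?B k + q * of_nat (Suc k) * ?B (Suc k)"
    using binomial_mat_times_row[of m q k'] binomial_mat_times_row[of m q k] Suc by simp_all
  have "(\<Sum>j\<le>m. ?B j * conj_upper u v x y q j k) =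
      (\<Sum>j\<in>{k', k, Suc k}. ?B j * conj_upper u v x y q j k)"
    by (rule sum_binomial_mat) (auto simp: conj_upper_def Suc)
  also have "\<dots> = ?B k' * (u * of_nat k + v) +
      ?B k * ((x + u * q) * of_nat k + y + (u * of_nat (Suc k) + v) * q) +
      ?B (Suc k) * ((x + u * q) * of_nat (Suc k) * q)"
    by (simp add: conj_upper_def Suc)
  also have "\<dots> = x * (of_nat m * ?B k) + y * ?B k + u * (of_nat m * ?B k')
     + u * q * (of_nat m * ?B k) + (u + v) * (?B k' + q * ?B k)"
    unfolding e by (simp add: Suc algebra_simps)
  also have "\<dots> = (x * of_nat m + y) * ?B k + (u * of_nat (Suc m) + v) * binomial_mat q (Suc m) k"
    by (simp add: Suc binomial_mat_Suc_Suc algebra_simps)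
  finally show ?thesis .
qed

text \<open>Combines the two relations; multiplying out the bidiagonal factors produces the
  coefficients \<open>delta\<close>, \<open>gamma\<close> and \<open>beta_Suc\<close>.\<close>

lemma binomial_mat_conj_production:
  "(\<Sum>i\<le>m. binomial_mat q m i * conj_production a b c u v x y q i k) =
     delta a b u v m * binomial_mat q (Suc m) k + gamma a b c u v x y m * binomial_mat q m k
     + (if m = 0 then 0 else beta_Suc c x y (m - 1) * binomial_mat q (m - 1) k)"
proof -
  let ?B = "binomial_mat q" and ?L = "conj_lower a b c q" and ?M = "conj_upper u v x y q"
  have ext: "conj_production a b c u v x y q i k = (\<Sum>j\<le>m. ?L i j * ?M j k)" if "i \<le> m" for i
    unfolding conj_production_def
    by (rule sum.mono_neutral_left) (use that in \<open>auto simp: conj_lower_def\<close>)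
  have "(\<Sum>i\<le>m. ?B m i * conj_production a b c u v x y q i k) =
      (\<Sum>i\<le>m. \<Sum>j\<le>m. ?B m i * ?L i j * ?M j k)"
    by (simp add: ext sum_distrib_left mult.assoc)
  also have "\<dots> = (\<Sum>j\<le>m. (\<Sum>i\<le>m. ?B m i * ?L i j) * ?M j k)"
    by (subst sum.swap) (simp add: sum_distrib_right)
  also have "\<dots> = (a * of_nat m + b) * (\<Sum>j\<le>m. ?B m j * ?M j k) +
      (if m = 0 then 0 else c * of_nat m * (\<Sum>j\<le>m. ?B (m - 1) j * ?M j k))"
    by (simp add: binomial_mat_conj_lower algebra_simps sum.distrib sum_distrib_left)
  also have "\<dots> = delta a b u v m * binomial_mat q (Suc m) k + gamma a b c u v x y m * binomial_mat q m k
     + (if m = 0 then 0 else beta_Suc c x y (m - 1) * binomial_mat q (m - 1) k)"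
  proof (cases m)
    case 0
    then show ?thesis
      using binomial_mat_conj_upper[of q 0 u v x y k]
      by (simp add: delta_def gamma_def algebra_simps)
  next
    case (Suc m')
    have "(\<Sum>j\<le>m. ?B (m - 1) j * ?M j k) = (\<Sum>j\<le>m'. ?B m' j * ?M j k)"
      by (simp add: Suc binomial_mat_eq_0)
    then show ?thesis
      by (simp add: binomial_mat_conj_upper Suc delta_def gamma_def beta_Suc_def
          algebra_simps power2_eq_square)
  qed
  finally show ?thesis .
qed

text \<open>Transposes one step of the recursion onto an arbitrary \<open>g\<close>; boundary terms
  vanish because row \<open>n\<close> ends at column \<open>n\<close>.\<close>

lemma Jmat_Suc_sum:
  "(\<Sum>m\<le>Suc n. Jmat a b c u v x y (Suc n) m * g m) =
    (\<Sum>m\<le>n. Jmat a b c u v x y n m * (delta a b u v m * g (Suc m) + gamma a b c u v x y m * g m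
     + (if m = 0 then 0 else beta_Suc c x y (m - 1) * g (m - 1))))"
proof -
  let ?J = "Jmat a b c u v x y n" and ?d = "delta a b u v" and ?g = "gamma a b c u v x y"
    and ?b = "beta_Suc c x y"
  have z: "?J (Suc n) = 0" "?J (Suc (Suc n)) = 0" by (simp_all add: Jmat_eq_0)
  have d: "(\<Sum>m\<le>Suc n. (if m = 0 then 0 else ?d (m - 1) * ?J (m - 1)) * g m)
      = (\<Sum>m\<le>n. ?J m * (?d m * g (Suc m)))"
    by (subst sum.atMost_Suc_shift) (simp add: ac_simps)
  have g: "(\<Sum>m\<le>Suc n. ?g m * ?J m * g m) = (\<Sum>m\<le>n. ?J m * (?g m * g m))"
    by (simp add: z ac_simps)
  have "(\<Sum>m\<le>Suc n. ?J m * (if m = 0 then 0 else ?b (m - 1) * g (m - 1)))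
      = (\<Sum>m\<le>n. ?J (Suc m) * (?b m * g m))"
    by (subst sum.atMost_Suc_shift) simp
  then have b: "(\<Sum>m\<le>Suc n. ?b m * ?J (Suc m) * g m)
      = (\<Sum>m\<le>n. ?J m * (if m = 0 then 0 else ?b (m - 1) * g (m - 1)))"
    by (simp add: z ac_simps)
  have "(\<Sum>m\<le>Suc n. Jmat a b c u v x y (Suc n) m * g m) =
      (\<Sum>m\<le>Suc n. (if m = 0 then 0 else ?d (m - 1) * ?J (m - 1)) * g m) +
      (\<Sum>m\<le>Suc n. ?g m * ?J m * g m) + (\<Sum>m\<le>Suc n. ?b m * ?J (Suc m) * g m)"
    unfolding sum.distrib[symmetric] by (rule sum.cong) (simp_all add: algebra_simps)
  also have "\<dots> = (\<Sum>m\<le>n. ?J m * (?d m * g (Suc m) + ?g m * g m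
     + (if m = 0 then 0 else ?b (m - 1) * g (m - 1))))"
    unfolding d g b by (simp only: sum.distrib[symmetric] distrib_left)
  finally show ?thesis .
qed

text \<open>\<open>Jmat_Suc_sum\<close> applies the recursion to the rows of
  \<open>binomial_mat q\<close>, and the intertwining relation trades it for multiplication by
  \<open>conj_production\<close> on the right.\<close>

lemma lower_mult_Jmat_binomial_mat:
  "lower_mult (Jmat a b c u v x y) (binomial_mat q) =
    output_mat 1 (conj_production a b c u v x y q)"
proof
  fix n
  let ?J = "Jmat a b c u v x y" and ?Q = "conj_production a b c u v x y q" and ?B = "binomial_mat q"
  show "lower_mult ?J ?B n = output_mat 1 ?Q n"
  proof (induction n)
    case 0
    show ?case by (rule ext) (auto simp: lower_mult_def binomial_mat_def binomial_eq_0)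
  next
    case (Suc n)
    show ?case
    proof
      fix k
      have "lower_mult ?J ?B (Suc n) k = (\<Sum>m\<le>n. ?J n m * (\<Sum>i\<le>m. ?B m i * ?Q i k))"
        unfolding lower_mult_def Jmat_Suc_sum binomial_mat_conj_production ..
      also have "\<dots> = (\<Sum>m\<le>n. ?J n m * (\<Sum>i\<le>n. ?B m i * ?Q i k))"
        by (intro sum.cong refl arg_cong2[of _ _ _ _ "(*)"] sum.mono_neutral_left)
          (auto simp: binomial_mat_eq_0)
      also have "\<dots> = (\<Sum>i\<le>n. lower_mult ?J ?B n i * ?Q i k)"
        unfolding lower_mult_def sum_distrib_left sum_distrib_right mult.assoc by (rule sum.swap)
      finally show "lower_mult ?J ?B (Suc n) k = output_mat 1 ?Q (Suc n) k"
        using Suc.IH by simp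
    qed
  qed
qed

text \<open>Column \<open>0\<close> of \<open>binomial_mat q\<close> consists of the powers of
  \<open>q\<close>; this brings row polynomials under the Hankel result.\<close>

lemma row_poly_eq_lower_mult: "row_poly A q n = lower_mult A (binomial_mat q) n 0"
  by (simp add: row_poly_def lower_mult_def binomial_mat_def)

lemma (in positive_cone) TP_Jmat:
  assumes "a \<in> C" "b \<in> C" "c \<in> C" "u \<in> C" "v \<in> C" "x \<in> C" "y \<in> C" "q \<in> C"
  shows "TP (lower_mult (Jmat a b c u v x y) (binomial_mat q))"
    and "TP (hankel (row_poly (Jmat a b c u v x y) q))"
proof -
  show "TP (lower_mult (Jmat a b c u v x y) (binomial_mat q))"
    unfolding lower_mult_Jmat_binomial_mat
    by (intro TP_output_mat TP_conj_production assms conj_production_band)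
  have "TP (hankel (\<lambda>n. output_mat 1 (conj_production a b c u v x y q) n 0))"
    by (intro TP_hankel_output_mat[where w' = 2] TP_conj_production assms)
      (simp_all add: conj_production_band)
  then show "TP (hankel (row_poly (Jmat a b c u v x y) q))"
    by (simp add: row_poly_eq_lower_mult[abs_def] lower_mult_Jmat_binomial_mat)
qed

text \<open>\<open>gamma\<close> and \<open>beta_Suc\<close> are homogeneous of degrees
  \<open>1\<close> and \<open>2\<close> in \<open>c, x, y\<close>. For a path of \<open>n\<close>
  steps from level \<open>0\<close> to level \<open>k\<close>, the number of level steps plus twice
  the number of down steps is \<open>n - k\<close>.\<close>

lemma Jmat_scale:
  "Jmat a b (q * c) u v (q * x) (q * y) n k = q ^ (n - k) * Jmat a b c u v x y n k"
proof (induction n arbitrary: k)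
  case (Suc n)
  have g: "gamma a b (q * c) u v (q * x) (q * y) k = q * gamma a b c u v x y k"
    by (simp add: gamma_def algebra_simps)
  have be: "beta_Suc (q * c) (q * x) (q * y) k = q * q * beta_Suc c x y k"
    by (simp add: beta_Suc_def algebra_simps)
  \<comment> \<open>Where the exponent truncates, the entry of \<open>Jmat\<close> is zero.\<close>
  have 1: "q * (q ^ (n - k) * Jmat a b c u v x y n k) = q ^ (Suc n - k) * Jmat a b c u v x y n k"
    by (cases "k \<le> n") (simp_all add: Suc_diff_le Jmat_eq_0)
  have 2: "q * q * (q ^ (n - Suc k) * Jmat a b c u v x y n (Suc k)) =
      q ^ (Suc n - k) * Jmat a b c u v x y n (Suc k)"
  proof (cases "Suc k \<le> n")
    case True
    then have "Suc n - k = Suc (Suc (n - Suc k))" by simp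
    then show ?thesis by simp
  qed (simp add: Jmat_eq_0)
  have 3: "q ^ (n - (k - 1)) = q ^ (Suc n - k)" if "k \<noteq> 0"
    using that by (cases k) auto
  let ?J = "Jmat a b c u v x y n"
  have "Jmat a b (q * c) u v (q * x) (q * y) (Suc n) k =
      (if k = 0 then 0 else delta a b u v (k - 1) * (q ^ (n - (k - 1)) * ?J (k - 1)))
      + q * gamma a b c u v x y k * (q ^ (n - k) * ?J k)
      + q * q * beta_Suc c x y k * (q ^ (n - Suc k) * ?J (Suc k))"
    by (simp add: Suc.IH g be)
  also have "\<dots> = (if k = 0 then 0 else delta a b u v (k - 1) * (q ^ (Suc n - k) * ?J (k - 1)))
      + gamma a b c u v x y k * (q * (q ^ (n - k) * ?J k))
      + beta_Suc c x y k * (q * q * (q ^ (n - Suc k) * ?J (Suc k)))"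
    using 3 by (simp add: ac_simps)
  also have "\<dots> = q ^ (Suc n - k) * Jmat a b c u v x y (Suc n) k"
    unfolding 1 2 by (simp add: distrib_left ac_simps)
  finally show ?case .
qed simp

lemma rev_row_poly_Jmat:
  "rev_row_poly (Jmat a b c u v x y) q = row_poly (Jmat a b (q * c) u v (q * x) (q * y)) 1"
  by (rule ext) (simp add: rev_row_poly_def row_poly_def Jmat_scale, simp add: mult.commute)

lemma row_poly_0: "row_poly A 0 n = A n 0"
proof -
  have "row_poly A 0 n = (\<Sum>k\<in>{0}. A n k * 0 ^ k)"
    unfolding row_poly_def by (rule sum.mono_neutral_right) (auto simp: power_0_left)
  then show ?thesis by simp
qed

section \<open>The cone of polynomials with nonnegative coefficients\<close>

lemma positive_cone_coeffwise_nonneg: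
  fixes Z :: "'v set"
  shows "positive_cone {p. coeffwise_nonneg Z p}"
proof
  fix p p' :: "('v, real) mpoly"
  assume "p \<in> {p. coeffwise_nonneg Z p}" "p' \<in> {p. coeffwise_nonneg Z p}"
  then have p: "vars p \<subseteq> Z" "vars p' \<subseteq> Z"
    and nn: "\<And>m. Poly_Mapping.lookup p m \<ge> 0" "\<And>m. Poly_Mapping.lookup p' m \<ge> 0"
    by (auto simp: coeffwise_nonneg_def)
  have "vars (p + p') \<subseteq> vars p \<union> vars p'"
    using keys_add[of p p'] by (auto simp: vars_def)
  then show "p + p' \<in> {p. coeffwise_nonneg Z p}"
    using p nn by (auto simp: coeffwise_nonneg_def lookup_add)
  have "Poly_Mapping.keys m \<subseteq> Z" if m: "m \<in> Poly_Mapping.keys (p * p')" for m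
  proof -
    obtain k l where kl: "m = k + l" "k \<in> Poly_Mapping.keys p" "l \<in> Poly_Mapping.keys p'"
      using m keys_mult[of p p'] by blast
    have "Poly_Mapping.keys k \<subseteq> vars p" "Poly_Mapping.keys l \<subseteq> vars p'"
      unfolding vars_def using kl by auto
    then show ?thesis
      using p keys_add[of k l] kl(1) by blast
  qed
  moreover have "0 \<le> Poly_Mapping.lookup (p * p') m" for m
    unfolding lookup_mult Sum_any.expand_set
    by (intro sum_nonneg mult_nonneg_nonneg nn) (auto simp: when_def nn)
  ultimately show "p * p' \<in> {p. coeffwise_nonneg Z p}"
    by (auto simp: coeffwise_nonneg_def vars_def)
qed (auto simp: coeffwise_nonneg_def vars_def lookup_one when_def)

lemma coeffwise_nonneg_Var: "i \<in> Z \<Longrightarrow> coeffwise_nonneg Z (Var i)"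
  by (auto simp: coeffwise_nonneg_def vars_def Var_def lookup_single when_def)

section \<open>The Stieltjes moment problem\<close>

text \<open>Supplies the sign at a root \<open>t0\<close>, where dividing out a factor X - t0 gives
  no information.\<close>

lemma poly_nonneg_by_right_continuity:
  fixes q :: "real poly"
  assumes "\<And>t. t0 < t \<Longrightarrow> 0 \<le> poly q t"
  shows "0 \<le> poly q t0"
proof (rule tendsto_lowerbound)
  show "(poly q \<longlongrightarrow> poly q t0) (at_right t0)"
    by (rule tendsto_mono[OF at_le[OF subset_UNIV] poly_isCont[unfolded isCont_def]])
  show "eventually (\<lambda>t. 0 \<le> poly q t) (at_right t0)"
    using assms by (auto simp: eventually_at_right_field intro!: exI[of _ "t0 + 1"])
qed simp

lemma poly_nonpos_by_left_continuity:
  fixes q :: "real poly"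
  assumes "s < t0" "\<And>t. s < t \<Longrightarrow> t < t0 \<Longrightarrow> poly q t \<le> 0"
  shows "poly q t0 \<le> 0"
proof (rule tendsto_upperbound)
  show "(poly q \<longlongrightarrow> poly q t0) (at_left t0)"
    by (rule tendsto_mono[OF at_le[OF subset_UNIV] poly_isCont[unfolded isCont_def]])
  show "eventually (\<lambda>t. poly q t \<le> 0) (at_left t0)"
    using assms by (auto simp: eventually_at_left_field intro!: exI[of _ s])
qed simp

text \<open>Beyond some \<open>R\<close> the polynomial is at least its value at \<open>0\<close>,
  so the minimum over a compact interval is global.\<close>

lemma poly_nonneg_attains_min:
  fixes p :: "real poly"
  assumes deg: "0 < degree p" and nonneg: "\<And>t. 0 \<le> t \<Longrightarrow> 0 \<le> poly p t"
  obtains t0 where "0 \<le> t0" "\<And>t. 0 \<le> t \<Longrightarrow> poly p t0 \<le> poly p t"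
proof -
  obtain a p' where p: "p = pCons a p'" "p' \<noteq> 0"
    using deg by (cases p) (auto split: if_splits)
  obtain R where R: "\<And>z. R \<le> norm z \<Longrightarrow> poly p 0 \<le> norm (poly p z)"
    using poly_infinity[OF p(2), of "poly p 0" a] unfolding p(1)[symmetric] by blast
  have "compact {0..\<bar>R\<bar>}" "{0..\<bar>R\<bar>} \<noteq> {}" "continuous_on {0..\<bar>R\<bar>} (poly p)"
    by (auto intro: continuous_intros)
  from continuous_attains_inf[OF this]
  obtain t0 where t0: "t0 \<in> {0..\<bar>R\<bar>}" "\<And>t. t \<in> {0..\<bar>R\<bar>} \<Longrightarrow> poly p t0 \<le> poly p t"
    by blast
  show ?thesis
  proof
    fix t :: real assume t: "0 \<le> t"
    show "poly p t0 \<le> poly p t"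
    proof (cases "t \<le> \<bar>R\<bar>")
      case False
      then have "poly p 0 \<le> poly p t"
        using R[of t] nonneg[OF t] t by auto
      then show ?thesis using t0(2)[of 0] by simp
    qed (use t0 t in auto)
  qed (use t0 in auto)
qed

text \<open>Subtracting from \<open>p\<close> its minimum over the half-line creates a root there: a factor \<open>X\<close> if the
  minimum is attained at \<open>0\<close>, and a factor \<open>(X - t\<^sub>0)\<^sup>2\<close> otherwise. Either factor can be absorbed
  into the functional.\<close>

lemma half_line_functional_nonneg:
  fixes \<Lambda> :: "real poly \<Rightarrow> real"
  assumes "\<And>f g. \<Lambda> (f + g) = \<Lambda> f + \<Lambda> g" "\<And>c f. \<Lambda> (smult c f) = c * \<Lambda> f"
    and "\<And>f. 0 \<le> \<Lambda> (f * f)" "\<And>f. 0 \<le> \<Lambda> ([:0, 1:] * (f * f))"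
    and "\<And>t. 0 \<le> t \<Longrightarrow> 0 \<le> poly p t"
  shows "0 \<le> \<Lambda> p"
  using assms
proof (induction "degree p" arbitrary: p \<Lambda> rule: less_induct)
  case less
  note add = less.prems(1) and smult = less.prems(2) and sq = less.prems(3) and Xsq = less.prems(4)
    and p = less.prems(5)
  have const: "0 \<le> \<Lambda> [:c:]" if "0 \<le> c" for c
    using smult[of c 1] sq[of 1] that by simp
  show ?case
  proof (cases "degree p = 0")
    case True
    then obtain c where "p = [:c:]" by (metis degree_eq_zeroE)
    then show ?thesis using const p[of 0] by simp
  next
    case False
    then obtain t0 where t0: "0 \<le> t0" and min: "\<And>t. 0 \<le> t \<Longrightarrow> poly p t0 \<le> poly p t"
      using poly_nonneg_attains_min[of p] p by blast
    define p' where "p' = p - [:poly p t0:]"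
    have p': "0 \<le> poly p' t" if "0 \<le> t" for t
      using min[OF that] by (simp add: p'_def)
    have "poly p' t0 = 0" by (simp add: p'_def)
    then obtain p1 where p1: "p' = [:- t0, 1:] * p1"
      by (auto simp: poly_eq_0_iff_dvd dvd_def)
    have "degree p' \<le> degree p"
      unfolding p'_def by (intro degree_diff_le) simp_all
    then have deg: "degree p1 < degree p"
      using p1 False by (cases "p1 = 0") (auto simp: degree_mult_eq simp del: mult_pCons_left)
    have p1_right: "0 \<le> poly p1 t" if "t0 < t" for t
    proof -
      have "0 \<le> (t - t0) * poly p1 t"
        using p'[of t] that t0 unfolding p1 by (simp add: algebra_simps)
      then show ?thesis using that by (simp add: zero_le_mult_iff)
    qed
    have "0 \<le> \<Lambda> p'"
    proof (cases "t0 = 0")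
      case True
      have "0 \<le> \<Lambda> ([:0, 1:] * p1)"
      proof (rule less.hyps[OF deg])
        show "0 \<le> poly p1 t" if "0 \<le> t" for t
          using that p1_right True poly_nonneg_by_right_continuity[of t p1] by simp
        \<comment> \<open>For the functional shifted by X the two positivity hypotheses change
          roles: X * (X * f^2) is the square of X * f.\<close>
        show "0 \<le> \<Lambda> ([:0, 1:] * ([:0, 1:] * (f * f)))" for f
          using sq[of "[:0, 1:] * f"] by (simp add: ac_simps del: mult_pCons_left mult_pCons_right)
      qed (use Xsq in \<open>simp_all only: distrib_left add mult_smult_right smult\<close>)
      then show ?thesis using p1 True by simp
    next
      case False
      then have t0: "0 < t0" using t0 by simp
      \<comment> \<open>At an interior minimum \<open>p1\<close> is nonpositive on the left and
        nonnegative on the right, so it vanishes at \<open>t0\<close> and the root is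
        double.\<close>
      have "poly p1 t \<le> 0" if "0 < t" "t < t0" for t
      proof -
        have "0 \<le> (t - t0) * poly p1 t"
          using p'[of t] that unfolding p1 by (simp add: algebra_simps)
        then show ?thesis using that by (simp add: zero_le_mult_iff)
      qed
      then have "poly p1 t0 \<le> 0"
        using t0 by (rule poly_nonpos_by_left_continuity[rotated])
      moreover have "0 \<le> poly p1 t0"
        using p1_right by (rule poly_nonneg_by_right_continuity)
      ultimately have "poly p1 t0 = 0" by simp
      then obtain p2 where p2: "p1 = [:- t0, 1:] * p2"
        by (auto simp: poly_eq_0_iff_dvd dvd_def)
      let ?g = "[:- t0, 1:]"
      have eq: "p' = ?g * ?g * p2" unfolding p1 p2 by (simp only: mult.assoc)
      have deg2: "degree p2 < degree p"
        using p2 deg by (cases "p2 = 0") (auto simp: degree_mult_eq simp del: mult_pCons_left)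
      have "0 \<le> \<Lambda> (?g * ?g * p2)"
      proof (rule less.hyps[OF deg2])
        have ne: "0 \<le> poly p2 t" if "0 \<le> t" "t \<noteq> t0" for t
        proof -
          have "0 \<le> (t - t0)\<^sup>2 * poly p2 t"
            using p'[OF that(1)] unfolding eq by (simp add: power2_eq_square algebra_simps)
          moreover have "0 < (t - t0)\<^sup>2" using that by simp
          ultimately show ?thesis by (simp add: zero_le_mult_iff)
        qed
        show "0 \<le> poly p2 t" if "0 \<le> t" for t
          using that ne poly_nonneg_by_right_continuity[of t p2] t0 by (cases "t = t0") auto
        show "0 \<le> \<Lambda> (?g * ?g * (f * f))" for f
          using sq[of "?g * f"] by (simp add: ac_simps del: mult_pCons_left mult_pCons_right)
        show "0 \<le> \<Lambda> (?g * ?g * ([:0, 1:] * (f * f)))" for f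
          using Xsq[of "?g * f"] by (simp add: ac_simps del: mult_pCons_left mult_pCons_right)
      qed (simp_all only: distrib_left add mult_smult_right smult)
      then show ?thesis using eq by simp
    qed
    moreover have "\<Lambda> p = \<Lambda> p' + \<Lambda> [:poly p t0:]"
      using add[of p' "[:poly p t0:]"] by (simp add: p'_def)
    ultimately show ?thesis using const[of "poly p t0"] p[OF t0] by simp
  qed
qed

section \<open>Moment functionals\<close>

definition moment_functional :: "(nat \<Rightarrow> real) \<Rightarrow> real poly \<Rightarrow> real" where
  "moment_functional r p = (\<Sum>i\<le>degree p. coeff p i * r i)"

lemma moment_functional_eq:
  "degree p \<le> N \<Longrightarrow> moment_functional r p = (\<Sum>i\<le>N. coeff p i * r i)"
  unfolding moment_functional_def by (rule sum.mono_neutral_left) (auto simp: coeff_eq_0)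

lemma moment_functional_add:
  "moment_functional r (p + q) = moment_functional r p + moment_functional r q"
proof -
  let ?N = "max (degree p) (degree q)"
  show ?thesis
    using moment_functional_eq[of p ?N r] moment_functional_eq[of q ?N r]
      moment_functional_eq[of "p + q" ?N r] degree_add_le_max[of p q]
    by (simp add: sum.distrib algebra_simps)
qed

lemma moment_functional_smult: "moment_functional r (smult c p) = c * moment_functional r p"
  using moment_functional_eq[of "smult c p" "degree p" r]
  by (simp add: moment_functional_def degree_smult_le sum_distrib_left mult.assoc)

lemma moment_functional_sum:
  "moment_functional r (sum f S) = (\<Sum>i\<in>S. moment_functional r (f i))"
  by (induction S rule: infinite_finite_induct)
    (simp_all add: moment_functional_add, simp_all add: moment_functional_def)

lemma moment_functional_monom: "moment_functional r (monom c n) = c * r n"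
proof -
  have "moment_functional r (monom c n) = (\<Sum>i\<in>{n}. coeff (monom c n) i * r i)"
    unfolding moment_functional_eq[OF degree_monom_le] by (rule sum.mono_neutral_right) auto
  then show ?thesis by simp
qed

lemma moment_functional_mult:
  "moment_functional r (f * g) =
    (\<Sum>i\<le>degree f. \<Sum>j\<le>degree g. coeff f i * coeff g j * r (i + j))"
proof -
  have "f * g = (\<Sum>i\<le>degree f. monom (coeff f i) i) * (\<Sum>j\<le>degree g. monom (coeff g j) j)"
    by (simp add: poly_as_sum_of_monoms)
  also have "\<dots> = (\<Sum>i\<le>degree f. \<Sum>j\<le>degree g. monom (coeff f i * coeff g j) (i + j))"
    by (simp add: sum_product mult_monom)
  finally show ?thesis
    by (simp add: moment_functional_sum moment_functional_monom)
qed

lemma moment_functional_X_mult: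
  "moment_functional r ([:0, 1:] * p) = moment_functional (\<lambda>i. r (Suc i)) p"
proof -
  have "moment_functional r ([:0, 1:] * p) = (\<Sum>i\<le>Suc (degree p). coeff (pCons 0 p) i * r i)"
    using moment_functional_eq[of "pCons 0 p" "Suc (degree p)" r] by (simp add: degree_pCons_le)
  also have "\<dots> = moment_functional (\<lambda>i. r (Suc i)) p"
    by (subst sum.atMost_Suc_shift) (simp add: moment_functional_def)
  finally show ?thesis .
qed

text \<open>Squares of polynomials encode positive semidefiniteness of the Hankel matrices of
  \<open>r\<close> and of the shifted sequence.\<close>

definition Stieltjes_positive :: "(nat \<Rightarrow> real) \<Rightarrow> bool" where
  "Stieltjes_positive r \<longleftrightarrow>
    (\<forall>f. 0 \<le> moment_functional r (f * f) \<and> 0 \<le> moment_functional (\<lambda>i. r (Suc i)) (f * f))"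

lemma Stieltjes_positive_poly:
  assumes "Stieltjes_positive r" "\<And>t. 0 \<le> t \<Longrightarrow> 0 \<le> poly p t"
  shows "0 \<le> moment_functional r p"
  by (rule half_line_functional_nonneg[of "moment_functional r", OF _ _ _ _ assms(2)])
    (use assms(1) in \<open>auto simp: Stieltjes_positive_def moment_functional_add moment_functional_smult
      moment_functional_X_mult simp del: mult_pCons_left\<close>)

section \<open>Approximation by finitely supported measures\<close>

definition discrete_moment :: "real set \<Rightarrow> (real \<Rightarrow> real) \<Rightarrow> nat \<Rightarrow> real" where
  "discrete_moment T w i = (\<Sum>t\<in>T. w t * t ^ i)"

text \<open>The vector of deviations of a near-minimiser of the squared distance is the coefficient
  vector of a polynomial that is almost nonpositive on the half-line.\<close>

lemma Stieltjes_positive_approx: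
  assumes r: "Stieltjes_positive r" and "0 < \<epsilon>"
  obtains T w where "finite T" "T \<subseteq> {0..}" "\<And>t. 0 \<le> w t"
    "(\<Sum>i\<le>N. (r i - discrete_moment T w i)\<^sup>2) < \<epsilon>"
proof -
  \<comment> \<open>A cone of sequences; the goal is that its squared distance \<open>d\<close> from
    \<open>r\<close>, on indices up to \<open>N\<close>, is zero.\<close>
  define S where "S = {discrete_moment T w | T w. finite T \<and> T \<subseteq> {0..} \<and> (\<forall>t. 0 \<le> w t)}"
  define dist2 where "dist2 m = (\<Sum>i\<le>N. (r i - m i)\<^sup>2)" for m
  define d where "d = Inf (dist2 ` S)"
  have scale: "(\<lambda>i. c * m i) \<in> S" if m: "m \<in> S" and c: "0 \<le> c" for m c
  proof -
    obtain T w where "finite T" "T \<subseteq> {0..}" "\<forall>t. 0 \<le> w t" "m = discrete_moment T w"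
      using m by (auto simp: S_def)
    moreover have "(\<lambda>i. c * discrete_moment T w i) = discrete_moment T (\<lambda>t. c * w t)"
      by (rule ext) (simp add: discrete_moment_def sum_distrib_left mult.assoc)
    moreover have "\<forall>t. 0 \<le> c * w t"
      using c calculation by simp
    ultimately show ?thesis unfolding S_def by blast
  qed
  have point: "(\<lambda>i. m i + s * t ^ i) \<in> S" if m: "m \<in> S" and "0 \<le> s" "0 \<le> t" for m s t
  proof -
    obtain T w where T: "finite T" "T \<subseteq> {0..}" "\<forall>t. 0 \<le> w t" "m = discrete_moment T w"
      using m by (auto simp: S_def)
    \<comment> \<open>The weight \<open>w\<close> is cut off outside \<open>T\<close>, since at a
      new point \<open>t\<close> its value is arbitrary.\<close>
    define w' where "w' = (\<lambda>z. (if z \<in> T then w z else 0) + (if z = t then s else 0))"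
    have "discrete_moment (insert t T) w' i = m i + s * t ^ i" for i
    proof -
      have "discrete_moment (insert t T) w' i =
          (\<Sum>z\<in>insert t T. (if z \<in> T then w z else 0) * z ^ i) +
          (\<Sum>z\<in>insert t T. (if z = t then s else 0) * z ^ i)"
        by (simp only: discrete_moment_def w'_def distrib_right sum.distrib)
      also have "(\<Sum>z\<in>insert t T. (if z \<in> T then w z else 0) * z ^ i) = (\<Sum>z\<in>T. w z * z ^ i)"
        by (rule sum.mono_neutral_cong_right) (use T in auto)
      also have "(\<Sum>z\<in>insert t T. (if z = t then s else 0) * z ^ i) =
          (\<Sum>z\<in>{t}. (if z = t then s else 0) * z ^ i)"
        by (rule sum.mono_neutral_right) (use T in auto)
      finally show ?thesis by (simp add: T discrete_moment_def)
    qed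
    then have "(\<lambda>i. m i + s * t ^ i) = discrete_moment (insert t T) w'" by (intro ext) simp
    moreover have "finite (insert t T)" "insert t T \<subseteq> {0..}" "\<forall>t. 0 \<le> w' t"
      using T that by (auto simp: w'_def)
    ultimately show ?thesis unfolding S_def by blast
  qed
  have "discrete_moment {} (\<lambda>_. 0) \<in> S" unfolding S_def by blast
  then have ne: "dist2 ` S \<noteq> {}" by blast
  have bdd: "bdd_below (dist2 ` S)"
    by (rule bdd_belowI[of _ 0]) (auto simp: dist2_def sum_nonneg)
  have d_le: "d \<le> dist2 m" if "m \<in> S" for m
    unfolding d_def using that bdd by (auto intro: cInf_lower)
  have d0: "0 \<le> d"
    unfolding d_def using ne by (intro cInf_greatest) (auto simp: dist2_def sum_nonneg)
  define R where "R = (\<Sum>i\<le>N. (r i)\<^sup>2)"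
  \<comment> \<open>Independent of \<eta>: the first summand comes from testing \<open>r\<close> on
    a polynomial, the second from bounding the inner product of deviation and approximant.\<close>
  define K where "K = (\<Sum>i\<le>N. r i) + (3 + 2 * R + 2 * d) / 2"
  have key: "d \<le> \<eta> * K" if \<eta>: "0 < \<eta>" "\<eta> < 1" for \<eta>
  proof -
    \<comment> \<open>The tolerance \<eta>^2 matches the quadratic terms of the perturbations of
      order \<eta> made below.\<close>
    have "\<exists>z\<in>dist2 ` S. z < d + \<eta>\<^sup>2"
      unfolding d_def using \<eta> by (intro cInf_lessD ne) simp
    then obtain m where m: "m \<in> S" "dist2 m < d + \<eta>\<^sup>2" by blast
    define w where "w i = r i - m i" for i
    have w2: "dist2 m = (\<Sum>i\<le>N. (w i)\<^sup>2)" by (simp add: dist2_def w_def)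
    have eta2: "\<eta>\<^sup>2 < 1" using \<eta> by (simp add: power_less_one_iff)
    have W: "(\<Sum>i\<le>N. w i * t ^ i) \<le> \<eta> * (\<Sum>i\<le>N. t ^ i)" if t: "0 \<le> t" for t
    proof -
      define G where "G = (\<Sum>i\<le>N. t ^ i)"
      define W where "W = (\<Sum>i\<le>N. w i * t ^ i)"
      have "(\<Sum>i\<in>{0}. t ^ i) \<le> G"
        unfolding G_def by (intro sum_mono2) (use t in auto)
      then have G: "1 \<le> G" by simp
      have "(\<Sum>i\<le>N. (t ^ i)\<^sup>2) \<le> (\<Sum>i\<le>N. t ^ i * G)"
        unfolding power2_eq_square
        by (intro sum_mono mult_left_mono) (use t in \<open>auto simp: G_def intro!: member_le_sum\<close>)
      then have V: "(\<Sum>i\<le>N. (t ^ i)\<^sup>2) \<le> G\<^sup>2"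
        by (simp add: G_def sum_distrib_right[symmetric] power2_eq_square)
      \<comment> \<open>The mass added at \<open>t\<close>: since \<open>s * G = \<eta>\<close>, the
        quadratic term is at most \<eta>^2, and near-minimality bounds the linear term
        \<open>W\<close>.\<close>
      define s where "s = \<eta> / G"
      have s: "0 \<le> s" "s * G = \<eta>" using \<eta> G by (auto simp: s_def)
      have "d \<le> dist2 (\<lambda>i. m i + s * t ^ i)"
        by (intro d_le point m s t)
      also have "\<dots> = (\<Sum>i\<le>N. (w i)\<^sup>2 + s\<^sup>2 * (t ^ i)\<^sup>2 - 2 * s * (w i * t ^ i))"
        unfolding dist2_def w_def by (rule sum.cong) (simp_all add: power2_eq_square algebra_simps)
      also have "\<dots> = dist2 m + s\<^sup>2 * (\<Sum>i\<le>N. (t ^ i)\<^sup>2) - 2 * s * W"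
        by (simp add: sum.distrib sum_subtractf sum_distrib_left w2 W_def)
      also have "\<dots> \<le> d + \<eta>\<^sup>2 + s\<^sup>2 * G\<^sup>2 - 2 * s * W"
        using m(2) mult_left_mono[OF V, of "s\<^sup>2"] by simp
      also have "s\<^sup>2 * G\<^sup>2 = \<eta>\<^sup>2" by (simp add: power_mult_distrib[symmetric] s)
      finally have "s * W \<le> \<eta> * \<eta>" by (simp add: power2_eq_square)
      then have "s * G * W \<le> \<eta> * (\<eta> * G)"
        using G mult_right_mono[of "s * W" "\<eta> * \<eta>" G] by (simp add: ac_simps)
      then have "W \<le> \<eta> * G" using \<eta> by (simp add: s)
      then show ?thesis by (simp add: W_def G_def)
    qed
    \<comment> \<open>Nonnegative on the half-line by \<open>W\<close>; the functional of
      \<open>r\<close> then bounds the inner product of \<open>w\<close> with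
      \<open>r\<close>.\<close>
    define p where "p = (\<Sum>i\<le>N. monom (\<eta> - w i) i)"
    have "0 \<le> poly p t" if "0 \<le> t" for t
      using W[OF that]
      by (simp add: p_def poly_sum poly_monom sum_subtractf sum_distrib_left left_diff_distrib)
    then have "0 \<le> moment_functional r p"
      by (rule Stieltjes_positive_poly[OF r])
    then have wr: "(\<Sum>i\<le>N. w i * r i) \<le> \<eta> * (\<Sum>i\<le>N. r i)"
      by (simp add: p_def moment_functional_sum moment_functional_monom sum_subtractf
          sum_distrib_left left_diff_distrib)
    define wm where "wm = (\<Sum>i\<le>N. w i * m i)"
    define M where "M = (\<Sum>i\<le>N. (m i)\<^sup>2)"
    have "M \<le> (\<Sum>i\<le>N. 2 * (r i)\<^sup>2 + 2 * (w i)\<^sup>2)"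
      unfolding M_def
    proof (rule sum_mono)
      fix i
      have "0 \<le> (r i + w i)\<^sup>2" by simp
      then show "(m i)\<^sup>2 \<le> 2 * (r i)\<^sup>2 + 2 * (w i)\<^sup>2"
        unfolding w_def by (simp add: power2_eq_square algebra_simps)
    qed
    also have "\<dots> = 2 * R + 2 * dist2 m"
      by (simp add: sum.distrib R_def w2 sum_distrib_left)
    finally have M: "M \<le> 2 * R + 2 * d + 2" using m(2) eta2 by simp
    \<comment> \<open>Shrinking \<open>m\<close> slightly bounds the inner product \<open>wm\<close>
      from below.\<close>
    have "d \<le> dist2 (\<lambda>i. (1 - \<eta>) * m i)"
      using \<eta> by (intro d_le scale m) simp
    also have "\<dots> = (\<Sum>i\<le>N. (w i)\<^sup>2 + 2 * \<eta> * (w i * m i) + \<eta>\<^sup>2 * (m i)\<^sup>2)"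
      unfolding dist2_def w_def by (rule sum.cong) (simp_all add: power2_eq_square algebra_simps)
    also have "\<dots> = dist2 m + 2 * \<eta> * wm + \<eta>\<^sup>2 * M"
      by (simp add: sum.distrib sum_distrib_left w2 wm_def M_def)
    also have "\<dots> \<le> d + \<eta>\<^sup>2 + 2 * \<eta> * wm + \<eta>\<^sup>2 * (2 * R + 2 * d + 2)"
      using m(2) mult_left_mono[OF M, of "\<eta>\<^sup>2"] by simp
    finally have "0 \<le> \<eta> * (\<eta> + 2 * wm + \<eta> * (2 * R + 2 * d + 2))"
      by (simp add: power2_eq_square algebra_simps)
    then have "0 \<le> \<eta> + 2 * wm + \<eta> * (2 * R + 2 * d + 2)"
      using \<eta>(1) by (simp only: zero_le_mult_iff) auto
    then have wm: "- (\<eta> * ((3 + 2 * R + 2 * d) / 2)) \<le> wm"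
      by (simp add: field_simps)
    have "d \<le> dist2 m" by (rule d_le[OF m(1)])
    also have "dist2 m = (\<Sum>i\<le>N. w i * r i) - wm"
      unfolding w2 wm_def sum_subtractf[symmetric]
      by (rule sum.cong) (simp_all add: w_def power2_eq_square algebra_simps)
    also have "\<dots> \<le> \<eta> * (\<Sum>i\<le>N. r i) + \<eta> * ((3 + 2 * R + 2 * d) / 2)"
      using wr wm by simp
    finally show ?thesis by (simp add: K_def distrib_left)
  qed
  have "d = 0"
  proof (rule ccontr)
    assume "d \<noteq> 0"
    then have d: "0 < d" using d0 by simp
    have "0 < K" using key[of "1 / 2"] d by simp
    \<comment> \<open>Small enough that \<open>key\<close> yields \<open>d\<close> \<le>
      \<open>d / 2\<close>.\<close>
    define \<eta> where "\<eta> = min (1 / 2) (d / (2 * K))"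
    have "0 < \<eta>" "\<eta> < 1" using d \<open>0 < K\<close> by (auto simp: \<eta>_def)
    then have "d \<le> \<eta> * K" by (rule key)
    also have "\<dots> \<le> d / (2 * K) * K"
      using \<open>0 < K\<close> by (intro mult_right_mono) (auto simp: \<eta>_def)
    also have "\<dots> = d / 2" using \<open>0 < K\<close> by simp
    finally show False using d by simp
  qed
  then have "\<exists>z\<in>dist2 ` S. z < \<epsilon>"
    using assms(2) unfolding d_def by (intro cInf_lessD ne) simp
  then show ?thesis
    using that unfolding S_def dist2_def by blast
qed

text \<open>First moments are bounded, so Markov's inequality gives tightness and Helly's theorem a
  weakly convergent subsequence. Powers are unbounded; their integrals pass to the limit through
  truncations, with an error controlled by the next moment.\<close>

lemma Stieltjes_moment_seq_limit:
  fixes \<mu> :: "nat \<Rightarrow> real measure"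
  assumes \<mu>: "\<And>n. real_distribution (\<mu> n)" and nonneg: "\<And>n. AE x in \<mu> n. 0 \<le> x"
    and int: "\<And>n i. integrable (\<mu> n) (\<lambda>x. x ^ i)"
    and lim: "\<And>i. (\<lambda>n. \<integral>x. x ^ i \<partial>\<mu> n) \<longlonglongrightarrow> r i"
  shows "Stieltjes_moment_seq r"
proof -
  obtain K where K: "0 < K" "\<And>n. norm (\<integral>x. x ^ 1 \<partial>\<mu> n) \<le> K"
    using convergent_imp_Bseq[OF convergentI[OF lim[of 1]]] by (auto simp: Bseq_def)
  have "tight \<mu>"
    unfolding tight_def
  proof (intro conjI allI impI \<mu>)
    fix \<epsilon> :: real assume \<epsilon>: "0 < \<epsilon>"
    define b where "b = 2 * K / \<epsilon>"
    have b: "0 < b" using \<epsilon> K by (simp add: b_def)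
    show "\<exists>a b. a < b \<and> (\<forall>n. 1 - \<epsilon> < measure (\<mu> n) {a<..b})"
    proof (rule exI[of _ "-1"], rule exI[of _ b], intro conjI allI)
      fix n
      interpret real_distribution "\<mu> n" by (rule \<mu>)
      have "measure (\<mu> n) {x \<in> space (\<mu> n). x \<ge> b} \<le> (\<integral>x. x \<partial>\<mu> n) / b"
        using int[of n 1] nonneg b by (intro integral_Markov_inequality_measure[of _ _ "{}"]) auto
      also have "\<dots> \<le> K / b"
        using K(2)[of n] b by (intro divide_right_mono) auto
      also have "\<dots> = \<epsilon> / 2" using \<epsilon> K by (simp add: b_def)
      finally have far: "measure (\<mu> n) {b..} \<le> \<epsilon> / 2"
        by (simp add: atLeast_def)
      have cover: "{-1<..b} \<union> ({b..} \<union> {..-1}) = UNIV" by auto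
      have "AE x in \<mu> n. x \<notin> {..-1}"
        using nonneg[of n] by eventually_elim auto
      then have neg: "measure (\<mu> n) {..-1} = 0" by (subst prob_eq_0) auto
      have "1 = measure (\<mu> n) ({-1<..b} \<union> ({b..} \<union> {..-1}))"
        using prob_space by (simp add: cover)
      also have "\<dots> \<le> measure (\<mu> n) {-1<..b} + measure (\<mu> n) ({b..} \<union> {..-1})"
        by (intro measure_Un_le) auto
      also have "measure (\<mu> n) ({b..} \<union> {..-1}) \<le> measure (\<mu> n) {b..} + measure (\<mu> n) {..-1}"
        by (intro measure_Un_le) auto
      finally show "1 - \<epsilon> < measure (\<mu> n) {-1<..b}" using far neg \<epsilon> by linarith
    qed (use b in simp)
  qed
  from tight_imp_convergent_subsubsequence[OF this strict_mono_id]
  obtain \<rho> M where \<rho>: "strict_mono \<rho>" and M: "real_distribution M"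
    and conv: "weak_conv_m (\<lambda>n. \<mu> (\<rho> n)) M"
    by (auto simp: comp_def)
  interpret M: real_distribution M by (rule M)
  have lim': "(\<lambda>n. \<integral>x. x ^ i \<partial>\<mu> (\<rho> n)) \<longlonglongrightarrow> r i" for i
    using LIMSEQ_subseq_LIMSEQ[OF lim \<rho>] by (simp add: comp_def)
  \<comment> \<open>Bounded and continuous, hence compatible with weak convergence; the cutoff
    \<open>Suc k\<close> is positive, so it can serve as divisor.\<close>
  define g where "g i k x = (min (max x 0) (real (Suc k))) ^ i" for i k and x :: real
  have g_meas [measurable]: "g i k \<in> borel_measurable borel" for i k
    unfolding g_def by measurable
  have g_bound: "norm (g i k x) \<le> real (Suc k) ^ i" for i k x
    unfolding g_def by (auto simp: norm_power abs_if intro!: power_mono)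
  have g_int: "integrable N (g i k)" if "real_distribution N" for N i k
  proof -
    interpret N: real_distribution N by fact
    show ?thesis
      by (rule N.integrable_const_bound[of _ "real (Suc k) ^ i"]) (use g_bound in auto)
  qed
  have g_conv: "(\<lambda>n. \<integral>x. g i k x \<partial>\<mu> (\<rho> n)) \<longlonglongrightarrow> (\<integral>x. g i k x \<partial>M)" for i k
  proof (rule weak_conv_imp_integral_bdd_continuous_conv[OF \<mu> M conv])
    show "isCont (g i k) x" for x
      unfolding g_def by (intro continuous_intros)
  qed (rule g_bound)
  have upper: "(\<integral>x. g i k x \<partial>M) \<le> r i" for i k
  proof (rule LIMSEQ_le[OF g_conv lim'])
    have "(\<integral>x. g i k x \<partial>\<mu> (\<rho> n)) \<le> (\<integral>x. x ^ i \<partial>\<mu> (\<rho> n))" for n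
    proof (rule integral_mono_AE[OF g_int[OF \<mu>] int])
      show "AE x in \<mu> (\<rho> n). g i k x \<le> x ^ i"
        using nonneg[of "\<rho> n"] by eventually_elim (auto simp: g_def intro!: power_mono)
    qed
    then show "\<exists>N. \<forall>n\<ge>N. (\<integral>x. g i k x \<partial>\<mu> (\<rho> n)) \<le> (\<integral>x. x ^ i \<partial>\<mu> (\<rho> n))" by blast
  qed
  \<comment> \<open>For x \<ge> 0, the integrand \<open>x ^ i - x ^ Suc i / real (Suc k)\<close> is
    at most \<open>g i k x\<close>: up to the cutoff \<open>g i k x\<close> is \<open>x ^ i\<close>,
    above it the integrand is nonpositive.\<close>
  have lower: "r i - r (Suc i) / real (Suc k) \<le> (\<integral>x. g i k x \<partial>M)" for i k
  proof (rule LIMSEQ_le[OF _ g_conv])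
    show "(\<lambda>n. (\<integral>x. x ^ i \<partial>\<mu> (\<rho> n)) - (\<integral>x. x ^ Suc i \<partial>\<mu> (\<rho> n)) / real (Suc k))
        \<longlonglongrightarrow> r i - r (Suc i) / real (Suc k)"
      by (intro tendsto_intros lim') simp
    have "(\<integral>x. x ^ i \<partial>\<mu> (\<rho> n)) - (\<integral>x. x ^ Suc i \<partial>\<mu> (\<rho> n)) / real (Suc k)
        \<le> (\<integral>x. g i k x \<partial>\<mu> (\<rho> n))" for n
    proof -
      have "(\<integral>x. x ^ i - x ^ Suc i / real (Suc k) \<partial>\<mu> (\<rho> n)) \<le> (\<integral>x. g i k x \<partial>\<mu> (\<rho> n))"
      proof (rule integral_mono_AE[OF _ g_int[OF \<mu>]])
        show "integrable (\<mu> (\<rho> n)) (\<lambda>x. x ^ i - x ^ Suc i / real (Suc k))"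
          by (intro Bochner_Integration.integrable_diff integrable_divide int)
        show "AE x in \<mu> (\<rho> n). x ^ i - x ^ Suc i / real (Suc k) \<le> g i k x"
          using nonneg[of "\<rho> n"]
        proof eventually_elim
          fix x :: real assume x: "0 \<le> x"
          show "x ^ i - x ^ Suc i / real (Suc k) \<le> g i k x"
          proof (cases "x \<le> real (Suc k)")
            case True
            then have "g i k x = x ^ i" using x by (simp add: g_def)
            moreover have "0 \<le> x ^ Suc i / real (Suc k)" using x by (intro divide_nonneg_nonneg) auto
            ultimately show ?thesis by linarith
          next
            case False
            then have "x ^ i * real (Suc k) \<le> x ^ i * x"
              using x by (intro mult_left_mono) auto
            then have "x ^ i \<le> x ^ Suc i / real (Suc k)"
              by (simp add: pos_le_divide_eq mult.commute)
            moreover have "0 \<le> g i k x" by (simp add: g_def)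
            ultimately show ?thesis by linarith
          qed
        qed
      qed
      then show ?thesis
        using int by (simp add: Bochner_Integration.integral_diff integrable_divide del: power_Suc)
    qed
    then show "\<exists>N. \<forall>n\<ge>N. (\<integral>x. x ^ i \<partial>\<mu> (\<rho> n)) - (\<integral>x. x ^ Suc i \<partial>\<mu> (\<rho> n)) / real (Suc k)
        \<le> (\<integral>x. g i k x \<partial>\<mu> (\<rho> n))" by blast
  qed
  have g_lim: "(\<lambda>k. \<integral>x. g i k x \<partial>M) \<longlonglongrightarrow> r i" for i
  proof (rule tendsto_sandwich)
    have "(\<lambda>k. r (Suc i) / real (Suc k)) \<longlonglongrightarrow> 0"
      using LIMSEQ_Suc[OF lim_const_over_n[of "r (Suc i)"]] by simp
    then show "(\<lambda>k. r i - r (Suc i) / real (Suc k)) \<longlonglongrightarrow> r i"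
      using tendsto_diff[OF tendsto_const[of "r i"]] by fastforce
  qed (use lower upper in auto)
  have moments: "integrable M (\<lambda>x. max x 0 ^ i)" "(\<integral>x. max x 0 ^ i \<partial>M) = r i" for i
  proof -
    have mono: "AE x in M. mono (\<lambda>k. g i k x)"
      by (rule AE_I2) (auto simp: mono_def g_def intro!: power_mono min.mono)
    have pos: "AE x in M. 0 \<le> g i k x" for k
      by (rule AE_I2) (simp add: g_def)
    have ptw: "AE x in M. (\<lambda>k. g i k x) \<longlonglongrightarrow> max x 0 ^ i"
    proof (rule AE_I2)
      fix x :: real
      obtain k0 :: nat where "max x 0 \<le> real k0" using real_arch_simple by blast
      then have "eventually (\<lambda>k. g i k x = max x 0 ^ i) sequentially"
        unfolding eventually_sequentially by (intro exI[of _ k0]) (auto simp: g_def min_def)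
      then show "(\<lambda>k. g i k x) \<longlonglongrightarrow> max x 0 ^ i" by (rule tendsto_eventually)
    qed
    show "integrable M (\<lambda>x. max x 0 ^ i)" "(\<integral>x. max x 0 ^ i \<partial>M) = r i"
      using integral_monotone_convergence_nonneg[OF g_int[OF M] mono pos ptw g_lim] by simp_all
  qed
  \<comment> \<open>The weak limit \<open>M\<close> is a measure on the whole line; its image under
    \<open>max x 0\<close> is one on the half-line, and \<open>moments\<close> gives its
    moments.\<close>
  define \<nu> where "\<nu> = distr M (restrict_space borel {0..}) (\<lambda>x::real. max x 0)"
  have meas: "(\<lambda>x::real. max x 0) \<in> M \<rightarrow>\<^sub>M restrict_space borel {0..}"
    by (rule measurable_restrict_space2) auto
  show ?thesis
    unfolding Stieltjes_moment_seq_def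
  proof (intro exI[of _ \<nu>] conjI allI)
    fix i
    have "(\<lambda>t::real. t ^ i) \<in> borel_measurable (restrict_space borel {0..})"
      by (intro measurable_restrict_space1) simp
    then show "integrable \<nu> (\<lambda>t. t ^ i)" "r i = (\<integral>t. t ^ i \<partial>\<nu>)"
      using moments[of i] meas by (simp_all add: \<nu>_def integrable_distr_eq integral_distr)
  qed (simp add: \<nu>_def)
qed

lemma Stieltjes_moment_seq_scale:
  assumes "Stieltjes_moment_seq s" "0 \<le> c"
  shows "Stieltjes_moment_seq (\<lambda>n. c * s n)"
proof -
  obtain \<mu> where \<mu>: "sets \<mu> = sets (restrict_space borel {0..})"
    "\<And>n. integrable \<mu> (\<lambda>t. t ^ n)" "\<And>n. s n = (\<integral>t. t ^ n \<partial>\<mu>)"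
    using assms(1) by (auto simp: Stieltjes_moment_seq_def)
  show ?thesis
    unfolding Stieltjes_moment_seq_def
  proof (intro exI[of _ "density \<mu> (\<lambda>_. ennreal c)"] conjI allI)
    fix n
    have "(\<lambda>t. t ^ n) \<in> borel_measurable \<mu>"
      using \<mu>(2)[of n] by (rule borel_measurable_integrable)
    then show "integrable (density \<mu> (\<lambda>_. ennreal c)) (\<lambda>t. t ^ n)"
      "c * s n = (\<integral>t. t ^ n \<partial>density \<mu> (\<lambda>_. ennreal c))"
      using \<mu>(2,3)[of n] assms(2) by (simp_all add: integrable_density integral_density)
  qed (simp add: \<mu>(1))
qed

text \<open>Approximants with error tending to zero are rescaled to probability measures, to which
  the limit lemma applies.\<close>

lemma Stieltjes_positive_normalized:
  assumes r: "Stieltjes_positive r" and r0: "r 0 = 1"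
  shows "Stieltjes_moment_seq r"
proof -
  have "\<exists>T w. finite T \<and> T \<subseteq> {0..} \<and> (\<forall>t. 0 \<le> w t) \<and>
      (\<Sum>i\<le>N. (r i - discrete_moment T w i)\<^sup>2) < 1 / real (N + 4)" for N
  proof -
    have "0 < 1 / real (N + 4)" by simp
    from Stieltjes_positive_approx[OF r this, of N] show ?thesis by metis
  qed
  then obtain T w where T: "\<And>N. finite (T N)" "\<And>N. T N \<subseteq> {0..}" and w: "\<And>N t. 0 \<le> w N t"
    and approx: "\<And>N. (\<Sum>i\<le>N. (r i - discrete_moment (T N) (w N) i)\<^sup>2) < 1 / real (N + 4)"
    by metis
  define m where "m N = discrete_moment (T N) (w N)" for N
  have term_le: "(r i - m N i)\<^sup>2 < 1 / real (N + 4)" if "i \<le> N" for i N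
    using approx[of N] member_le_sum[of i "{..N}" "\<lambda>i. (r i - m N i)\<^sup>2"] that
    by (simp add: m_def)
  have m_lim: "(\<lambda>N. m N i) \<longlonglongrightarrow> r i" for i
  proof -
    have "(\<lambda>N. (r i - m N i)\<^sup>2) \<longlonglongrightarrow> 0"
    proof (rule tendsto_sandwich[OF _ _ tendsto_const])
      show "(\<lambda>N. 1 / real (N + 4)) \<longlonglongrightarrow> 0"
        using LIMSEQ_ignore_initial_segment[OF lim_const_over_n[of 1], of 4] by simp
      show "\<forall>\<^sub>F N in sequentially. (r i - m N i)\<^sup>2 \<le> 1 / real (N + 4)"
        using eventually_ge_at_top[of i] by eventually_elim (use term_le in \<open>auto intro: less_imp_le\<close>)
    qed simp
    then have "(\<lambda>N. sqrt ((r i - m N i)\<^sup>2)) \<longlonglongrightarrow> sqrt 0" by (rule tendsto_real_sqrt)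
    then have "(\<lambda>N. r i - m N i) \<longlonglongrightarrow> 0"
      by (simp add: tendsto_rabs_zero_iff)
    then have "(\<lambda>N. r i - (r i - m N i)) \<longlonglongrightarrow> r i - 0" by (intro tendsto_intros)
    then show ?thesis by simp
  qed
  \<comment> \<open>The squared error is below \<open>1\<close>, so an approximant of
    \<open>r 0 = 1\<close> is positive and can serve as divisor.\<close>
  have m_pos: "0 < m N 0" for N
  proof (rule ccontr)
    assume "\<not> 0 < m N 0"
    then have "1 \<le> r 0 - m N 0" using r0 by simp
    then have "1 \<le> (r 0 - m N 0)\<^sup>2" by (rule one_le_power)
    also have "\<dots> < 1 / real (N + 4)" by (rule term_le) simp
    also have "\<dots> \<le> 1" by simp
    finally show False by simp
  qed
  define v where "v N t = w N t / m N 0" for N t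
  have v: "0 \<le> v N t" for N t using w m_pos[of N] by (simp add: v_def)
  define P where "P N = point_measure (T N) (v N)" for N
  \<comment> \<open>\<open>point_measure\<close> lives on the subsets of \<open>T N\<close>; the
    limit argument works with Borel measures on the reals.\<close>
  define \<mu> where "\<mu> N = distr (P N) borel (\<lambda>t. t)" for N
  have meas: "(\<lambda>t. t) \<in> P N \<rightarrow>\<^sub>M (borel :: real measure)" for N
    by (simp add: P_def)
  have mom: "(\<Sum>t\<in>T N. v N t * t ^ i) = m N i / m N 0" for i N
    by (simp add: v_def m_def discrete_moment_def sum_divide_distrib)
  show ?thesis
  proof (rule Stieltjes_moment_seq_limit)
    fix N i
    have "(\<Sum>t\<in>T N. v N t) = 1" using mom[of N 0] m_pos[of N] by simp
    then have "emeasure (P N) (space (P N)) = 1"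
      using T[of N] v by (simp add: P_def space_point_measure emeasure_point_measure_finite sum_ennreal)
    then interpret P: prob_space "P N" by (rule prob_spaceI)
    show "real_distribution (\<mu> N)"
      unfolding \<mu>_def using meas by (rule P.real_distribution_distr)
    have "AE t in P N. 0 \<le> t"
      unfolding P_def AE_point_measure using T(2)[of N] by auto
    then show "AE x in \<mu> N. 0 \<le> x"
      unfolding \<mu>_def by (subst AE_distr_iff[OF meas]) auto
    show "integrable (\<mu> N) (\<lambda>x. x ^ i)"
      unfolding \<mu>_def using T by (subst integrable_distr_eq[OF meas]) (auto simp: P_def integrable_point_measure_finite)
  next
    fix i
    have "(\<integral>x. x ^ i \<partial>\<mu> N) = m N i / m N 0" for N
      unfolding \<mu>_def using T v
      by (subst integral_distr[OF meas]) (auto simp: P_def lebesgue_integral_point_measure_finite mom)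
    moreover have "(\<lambda>N. m N i / m N 0) \<longlonglongrightarrow> r i / r 0"
      using r0 by (intro tendsto_divide m_lim) simp
    ultimately show "(\<lambda>N. \<integral>x. x ^ i \<partial>\<mu> N) \<longlonglongrightarrow> r i"
      using r0 by simp
  qed
qed

text \<open>Dividing by \<open>r 0\<close> reduces to the normalised case. If
  \<open>r 0 = 0\<close>, positivity on squares forces every term to vanish.\<close>

theorem Stieltjes_moment_theorem:
  assumes r: "Stieltjes_positive r"
  shows "Stieltjes_moment_seq r"
proof (cases "r 0 = 0")
  case True
  have "r n = 0" for n
  proof (rule ccontr)
    assume n: "r n \<noteq> 0"
    \<comment> \<open>Makes the functional take the value \<open>-1\<close> on the square of X^n +
      c.\<close>
    define c where "c = - (r (n + n) + 1) / (2 * r n)"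
    let ?f = "monom 1 n + monom c 0 :: real poly"
    have "?f * ?f = monom 1 (n + n) + (monom c n + monom c n) + monom (c * c) 0"
      by (simp only: ring_distribs mult_monom mult_1_left mult_1_right add_0_left add_0_right add.assoc)
    then have "moment_functional r (?f * ?f) = r (n + n) + 2 * c * r n"
      by (simp only: moment_functional_add moment_functional_monom True)
    also have "\<dots> = -1" using n by (simp add: c_def field_simps)
    finally show False using r unfolding Stieltjes_positive_def by (metis neg_0_le_iff_le not_one_le_zero)
  qed
  then have "r = (\<lambda>_. 0)" by auto
  then show ?thesis
    unfolding Stieltjes_moment_seq_def
    by (intro exI[of _ "null_measure (restrict_space borel {0..})"])
      (auto intro!: measurable_restrict_space1)
next
  case False
  have "0 \<le> moment_functional r ([:1:] * [:1:])"
    using r unfolding Stieltjes_positive_def by blast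
  then have pos: "0 < r 0" using False by (simp add: moment_functional_def)
  have "moment_functional (\<lambda>i. s i / r 0) p = moment_functional s p / r 0" for s p
    by (simp add: moment_functional_def sum_divide_distrib)
  then have "Stieltjes_positive (\<lambda>i. r i / r 0)"
    using r pos unfolding Stieltjes_positive_def by simp
  then have "Stieltjes_moment_seq (\<lambda>i. r i / r 0)"
    by (rule Stieltjes_positive_normalized) (use pos in simp)
  from Stieltjes_moment_seq_scale[OF this, of "r 0"] show ?thesis
    using pos by simp
qed

section \<open>Positive semidefiniteness and the convolution\<close>

text \<open>One step of Gaussian elimination: the matrix factors as \<open>L\<close> times
  \<open>N\<close>, with \<open>L\<close> unit lower triangular and the first column of
  \<open>N\<close> cleared below the pivot.\<close>

lemma minor_schur_complement:
  fixes A :: "nat \<Rightarrow> nat \<Rightarrow> 'a::field"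
  assumes \<alpha>: "A (r 0) (c 0) \<noteq> 0"
  shows "minor A (Suc m) r c = A (r 0) (c 0) *
    minor (\<lambda>i j. A i j - A i (c 0) * A (r 0) j / A (r 0) (c 0)) m (\<lambda>i. r (Suc i)) (\<lambda>j. c (Suc j))"
proof -
  define L where "L i k = (if i = k then 1 else if k = 0 then A (r i) (c 0) / A (r 0) (c 0) else 0)"
    for i k :: nat
  define N where "N k j = (if k = 0 then A (r 0) (c j)
    else A (r k) (c j) - A (r k) (c 0) * A (r 0) (c j) / A (r 0) (c 0))" for k j
  let ?mat = "\<lambda>B. Matrix.mat (Suc m) (Suc m) (\<lambda>(i, j). B i j)"
  have "A (r i) (c j) = (\<Sum>k=0..<Suc m. L i k * N k j)" if "i < Suc m" for i j
  proof -
    have "(\<Sum>k=0..<Suc m. L i k * N k j) = (\<Sum>k\<in>{0, i}. L i k * N k j)"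
      by (rule sum.mono_neutral_right) (use that in \<open>auto simp: L_def\<close>)
    then show ?thesis by (cases "i = 0") (auto simp: L_def N_def)
  qed
  then have "Matrix.mat (Suc m) (Suc m) (\<lambda>(i, j). A (r i) (c j)) = ?mat L * ?mat N"
    by (intro eq_matI) (auto simp: scalar_prod_def simp del: sum.op_ivl_Suc)
  then have "minor A (Suc m) r c = minor L (Suc m) (\<lambda>i. i) (\<lambda>j. j) * minor N (Suc m) (\<lambda>i. i) (\<lambda>j. j)"
    unfolding minor_def using det_mult[of "?mat L" "Suc m" "?mat N"] by simp
  also have "minor L (Suc m) (\<lambda>i. i) (\<lambda>j. j) = minor L m Suc Suc"
    by (subst minor_first_row) (simp_all add: L_def)
  also have "Matrix.mat m m (\<lambda>(i, j). L (Suc i) (Suc j)) = 1\<^sub>m m"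
    by (rule eq_matI) (auto simp: L_def)
  then have "minor L m Suc Suc = 1" by (simp add: minor_def)
  also have "minor N (Suc m) (\<lambda>i. i) (\<lambda>j. j) = N 0 0 * minor N m Suc Suc"
  proof -
    have "insert_index 0 = Suc" by (auto simp: insert_index_def)
    moreover have "N i 0 = 0" if "i \<noteq> 0" for i using \<alpha> that by (simp add: N_def)
    ultimately show ?thesis
      using minor_single_col[of 0 m 0 N "\<lambda>i. i" "\<lambda>j. j"] by (simp add: comp_def)
  qed
  also have "minor N m Suc Suc = minor (\<lambda>i j. A i j - A i (c 0) * A (r 0) j / A (r 0) (c 0)) m
      (\<lambda>i. r (Suc i)) (\<lambda>j. c (Suc j))"
    by (rule minor_cong) (simp add: N_def)
  finally show ?thesis by (simp add: N_def)
qed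

text \<open>Induction by completing the square. With a positive pivot, principal minors of the Schur
  complement are principal minors of \<open>A\<close> divided by the pivot; with a zero pivot,
  minors of size \<open>2\<close> force the first row to vanish.\<close>

lemma psd_of_principal_minors:
  fixes A :: "nat \<Rightarrow> nat \<Rightarrow> real"
  assumes "\<And>i j. A i j = A j i" "\<And>m r. strict_mono_on {..<m} r \<Longrightarrow> 0 \<le> minor A m r r"
  shows "0 \<le> (\<Sum>i<n. \<Sum>j<n. \<xi> i * \<xi> j * A i j)"
  using assms
proof (induction n arbitrary: A \<xi>)
  case (Suc n)
  note sym = Suc.prems(1) and minors = Suc.prems(2)
  define \<alpha> where "\<alpha> = A 0 0"
  have "0 \<le> minor A (Suc 0) (\<lambda>i. i) (\<lambda>i. i)"
    by (rule minors) (auto simp: strict_mono_on_def)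
  then have \<alpha>0: "0 \<le> \<alpha>" by (simp add: minor_1 \<alpha>_def)
  have split: "(\<Sum>i<Suc n. \<Sum>j<Suc n. \<xi> i * \<xi> j * A i j) = \<xi> 0 * \<xi> 0 * \<alpha> +
      2 * \<xi> 0 * (\<Sum>j<n. \<xi> (Suc j) * A 0 (Suc j)) +
      (\<Sum>i<n. \<Sum>j<n. \<xi> (Suc i) * \<xi> (Suc j) * A (Suc i) (Suc j))"
  proof -
    have 1: "(\<Sum>i<n. \<xi> (Suc i) * \<xi> 0 * A (Suc i) 0) = \<xi> 0 * (\<Sum>j<n. \<xi> (Suc j) * A 0 (Suc j))"
      unfolding sum_distrib_left by (rule sum.cong) (simp_all add: sym[of _ 0])
    have 2: "(\<Sum>j<n. \<xi> 0 * \<xi> (Suc j) * A 0 (Suc j)) = \<xi> 0 * (\<Sum>j<n. \<xi> (Suc j) * A 0 (Suc j))"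
      unfolding sum_distrib_left by (rule sum.cong) simp_all
    show ?thesis
      unfolding sum.lessThan_Suc_shift sum.distrib 1 2 by (simp add: \<alpha>_def)
  qed
  show ?case
  proof (cases "\<alpha> = 0")
    case True
    have row: "A 0 (Suc j) = 0" for j
    proof -
      let ?r = "\<lambda>i. if i = 0 then 0 else Suc j"
      have "0 \<le> minor A (Suc (Suc 0)) ?r ?r"
        by (rule minors) (auto simp: strict_mono_on_def)
      then have "A 0 (Suc j) * A 0 (Suc j) \<le> 0"
        using True sym[of "Suc j" 0] by (simp add: minor_2 \<alpha>_def)
      then show ?thesis by (auto simp: mult_le_0_iff)
    qed
    have "0 \<le> (\<Sum>i<n. \<Sum>j<n. \<xi> (Suc i) * \<xi> (Suc j) * A (Suc i) (Suc j))"
    proof (rule Suc.IH[of "\<lambda>i j. A (Suc i) (Suc j)" "\<lambda>i. \<xi> (Suc i)"])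
      fix m and r :: "nat \<Rightarrow> nat" assume "strict_mono_on {..<m} r"
      then have "0 \<le> minor A m (\<lambda>i. Suc (r i)) (\<lambda>i. Suc (r i))"
        by (intro minors) (auto simp: strict_mono_on_def)
      also have "\<dots> = minor (\<lambda>i j. A (Suc i) (Suc j)) m r r" by (rule minor_cong) simp
      finally show "0 \<le> minor (\<lambda>i j. A (Suc i) (Suc j)) m r r" .
    qed (rule sym)
    then show ?thesis unfolding split by (simp add: True row)
  next
    case False
    then have \<alpha>: "0 < \<alpha>" using \<alpha>0 by simp
    define A' where "A' i j = A (Suc i) (Suc j) - A (Suc i) 0 * A 0 (Suc j) / \<alpha>" for i j
    define \<sigma> where "\<sigma> = (\<Sum>j<n. \<xi> (Suc j) * A 0 (Suc j))"
    have "0 \<le> (\<Sum>i<n. \<Sum>j<n. \<xi> (Suc i) * \<xi> (Suc j) * A' i j)"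
    proof (rule Suc.IH[of A' "\<lambda>i. \<xi> (Suc i)"])
      show "A' i j = A' j i" for i j
        unfolding A'_def using sym[of "Suc i" "Suc j"] sym[of "Suc i" 0] sym[of "Suc j" 0] by (simp add: mult.commute)
      fix m and r :: "nat \<Rightarrow> nat" assume r: "strict_mono_on {..<m} r"
      define r' where "r' i = (case i of 0 \<Rightarrow> 0 | Suc i' \<Rightarrow> Suc (r i'))" for i
      have "strict_mono_on {..<Suc m} r'"
        using r by (auto simp: strict_mono_on_def r'_def split: nat.split)
      then have "0 \<le> minor A (Suc m) r' r'" by (rule minors)
      also have "\<dots> = A (r' 0) (r' 0) * minor (\<lambda>i j. A i j - A i (r' 0) * A (r' 0) j / A (r' 0) (r' 0)) m
          (\<lambda>i. r' (Suc i)) (\<lambda>j. r' (Suc j))"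
        by (rule minor_schur_complement) (use False in \<open>simp add: r'_def \<alpha>_def\<close>)
      also have "\<dots> = \<alpha> * minor A' m r r"
        unfolding r'_def by (simp add: \<alpha>_def) (rule disjI2, rule minor_cong, simp add: A'_def \<alpha>_def)
      finally show "0 \<le> minor A' m r r" using \<alpha> by (simp add: zero_le_mult_iff)
    qed
    also have "(\<Sum>i<n. \<Sum>j<n. \<xi> (Suc i) * \<xi> (Suc j) * A' i j) =
        (\<Sum>i<n. \<Sum>j<n. \<xi> (Suc i) * \<xi> (Suc j) * A (Suc i) (Suc j)) - \<sigma> * \<sigma> / \<alpha>"
    proof -
      have "\<sigma> * \<sigma> / \<alpha> = (\<Sum>i<n. \<Sum>j<n. \<xi> (Suc i) * \<xi> (Suc j) * (A (Suc i) 0 * A 0 (Suc j) / \<alpha>))"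
        unfolding \<sigma>_def sum_product sum_divide_distrib
        by (intro sum.cong refl) (simp add: sym[of _ 0])
      then show ?thesis
        by (simp add: A'_def right_diff_distrib sum_subtractf)
    qed
    finally have "\<sigma> * \<sigma> / \<alpha> \<le> (\<Sum>i<n. \<Sum>j<n. \<xi> (Suc i) * \<xi> (Suc j) * A (Suc i) (Suc j))" by simp
    moreover have "0 \<le> (\<alpha> * \<xi> 0 + \<sigma>)\<^sup>2 / \<alpha>" using \<alpha> by simp
    moreover have "(\<alpha> * \<xi> 0 + \<sigma>)\<^sup>2 / \<alpha> = \<xi> 0 * \<xi> 0 * \<alpha> + 2 * \<xi> 0 * \<sigma> + \<sigma> * \<sigma> / \<alpha>"
      using \<alpha> by (simp add: power2_eq_square field_simps)
    ultimately show ?thesis unfolding split \<sigma>_def by linarith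
  qed
qed simp

lemma positive_cone_nonneg_real: "positive_cone {x::real. 0 \<le> x}"
  by unfold_locales auto

text \<open>Principal minors of the shifted Hankel matrix are minors of \<open>hankel s\<close> with
  columns shifted by one, so total positivity covers both conditions.\<close>

lemma Stieltjes_positive_if_TP_hankel:
  assumes "positive_cone.TP {x::real. 0 \<le> x} (hankel s)"
  shows "Stieltjes_positive s"
proof -
  interpret positive_cone "{x::real. 0 \<le> x}" by (rule positive_cone_nonneg_real)
  have psd: "0 \<le> moment_functional s' (f * f)"
    if "\<And>m r. strict_mono_on {..<m} r \<Longrightarrow> 0 \<le> minor (hankel s') m r r" for s' f
    using psd_of_principal_minors[of "hankel s'" "coeff f" "Suc (degree f)"] that
    by (simp add: moment_functional_mult hankel_def add.commute lessThan_Suc_atMost del: sum.lessThan_Suc)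
  show ?thesis
    unfolding Stieltjes_positive_def
  proof (intro allI conjI psd)
    fix m and r :: "nat \<Rightarrow> nat" assume r: "strict_mono_on {..<m} r"
    show "0 \<le> minor (hankel s) m r r"
      using TPD[OF assms r r] by simp
    have "strict_mono_on {..<m} (\<lambda>i. Suc (r i))"
      using r by (auto simp: strict_mono_on_def)
    then have "0 \<le> minor (hankel s) m r (\<lambda>i. Suc (r i))"
      using TPD[OF assms r] by simp
    also have "\<dots> = minor (hankel (\<lambda>i. s (Suc i))) m r r"
      by (rule minor_cong) (simp add: hankel_def)
    finally show "0 \<le> minor (hankel (\<lambda>i. s (Suc i))) m r r" .
  qed
qed

text \<open>For a fixed polynomial both conditions are linear in the sequence, so they survive
  integration.\<close>

lemma Stieltjes_positive_integral:
  assumes int: "\<And>n. integrable M (\<lambda>\<omega>. F \<omega> n)"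
    and pos: "\<And>\<omega>. \<omega> \<in> space M \<Longrightarrow> Stieltjes_positive (F \<omega>)"
  shows "Stieltjes_positive (\<lambda>n. \<integral>\<omega>. F \<omega> n \<partial>M)"
proof -
  have eq: "moment_functional (\<lambda>n. \<integral>\<omega>. F \<omega> (h n) \<partial>M) p = (\<integral>\<omega>. moment_functional (\<lambda>n. F \<omega> (h n)) p \<partial>M)"
    for p and h :: "nat \<Rightarrow> nat"
    using int by (simp add: moment_functional_def Bochner_Integration.integral_sum)
  show ?thesis
    unfolding Stieltjes_positive_def eq[of "\<lambda>n. n"] eq[of Suc]
    using pos by (intro allI conjI Bochner_Integration.integral_nonneg) (auto simp: Stieltjes_positive_def)
qed

lemma Jmat_convolution_Stieltjes:
  fixes a b c u v x y :: real
  assumes par: "0 \<le> a" "0 \<le> b" "0 \<le> c" "0 \<le> u" "0 \<le> v" "0 \<le> x" "0 \<le> y"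
    and s: "Stieltjes_moment_seq s" and t: "Stieltjes_moment_seq t"
  shows "Stieltjes_moment_seq (\<lambda>n. \<Sum>k\<le>n. Jmat a b c u v x y n k * s k * t (n - k))"
proof -
  let ?J = "Jmat a b c u v x y"
  obtain \<mu> where \<mu>: "sets \<mu> = sets (restrict_space borel {0..})"
    "\<And>n. integrable \<mu> (\<lambda>p. p ^ n)" "\<And>n. s n = (\<integral>p. p ^ n \<partial>\<mu>)"
    using s by (auto simp: Stieltjes_moment_seq_def)
  obtain \<nu> where \<nu>: "sets \<nu> = sets (restrict_space borel {0..})"
    "\<And>n. integrable \<nu> (\<lambda>z. z ^ n)" "\<And>n. t n = (\<integral>z. z ^ n \<partial>\<nu>)"
    using t by (auto simp: Stieltjes_moment_seq_def)
  have space: "space \<mu> = {0..}" "space \<nu> = {0..}"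
    using sets_eq_imp_space_eq[OF \<mu>(1)] sets_eq_imp_space_eq[OF \<nu>(1)] by auto
  interpret positive_cone "{x::real. 0 \<le> x}" by (rule positive_cone_nonneg_real)
  have pointwise: "Stieltjes_positive (\<lambda>n. \<Sum>k\<le>n. ?J n k * p ^ k * z ^ (n - k))"
    if "0 \<le> p" "0 \<le> z" for p z
  proof -
    \<comment> \<open>Scaling \<open>c, x, y\<close> by \<open>z\<close> absorbs the factor
      \<open>z ^ (n - k)\<close> and leaves row polynomials at \<open>p\<close>.\<close>
    have "(\<lambda>n. \<Sum>k\<le>n. ?J n k * p ^ k * z ^ (n - k)) =
        row_poly (Jmat a b (z * c) u v (z * x) (z * y)) p"
      by (rule ext) (simp add: row_poly_def Jmat_scale, simp add: ac_simps)
    then show ?thesis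
      using TP_Jmat(2)[of a b "z * c" u v "z * x" "z * y" p] par that
      by (simp add: Stieltjes_positive_if_TP_hankel)
  qed
  \<comment> \<open>Integrating over \<open>z\<close> with \<open>p\<close> fixed turns powers of
    \<open>z\<close> into terms of \<open>t\<close>; integrating over \<open>p\<close> then brings
    in \<open>s\<close>.\<close>
  have "Stieltjes_positive (\<lambda>n. \<Sum>k\<le>n. ?J n k * p ^ k * t (n - k))" if "0 \<le> p" for p
    using Stieltjes_positive_integral[of \<nu> "\<lambda>z n. \<Sum>k\<le>n. ?J n k * p ^ k * z ^ (n - k)"]
      pointwise[OF that] \<nu>(2,3) by (simp add: space)
  then have "Stieltjes_positive (\<lambda>n. \<Sum>k\<le>n. ?J n k * s k * t (n - k))"
    using Stieltjes_positive_integral[of \<mu> "\<lambda>p n. \<Sum>k\<le>n. ?J n k * p ^ k * t (n - k)"] \<mu>(2,3)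
    by (simp add: space)
  then show ?thesis by (rule Stieltjes_moment_theorem)
qed

lemma coeffwise_TP_eq: "coeffwise_TP Z A \<longleftrightarrow> positive_cone.TP {p. coeffwise_nonneg Z p} A"
  by (simp add: coeffwise_TP_def positive_cone.TP_def[OF positive_cone_coeffwise_nonneg])

lemma coeffwise_log_convex_3:
  assumes "coeffwise_Hankel_TP Z s"
  shows "coeffwise_log_convex 3 Z s"
  using positive_cone.iterated_LC_mem[OF positive_cone_coeffwise_nonneg[of Z], of s] assms
  by (simp add: coeffwise_log_convex_def coeffwise_Hankel_TP_def coeffwise_TP_eq)

lemma coeffwise_TP_mono: "coeffwise_TP Z A \<Longrightarrow> Z \<subseteq> Z' \<Longrightarrow> coeffwise_TP Z' A"
  unfolding coeffwise_TP_def coeffwise_nonneg_def by blast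

theorem theorem4p2:
  shows
    "coeffwise_TP {Ia, Ib, Ic, Iu, Iv, Ix, Iy, Iq} (lower_mult J_indet (binomial_mat (Var Iq)))
     \<and>
     (coeffwise_Hankel_TP {Ia, Ib, Ic, Iu, Iv, Ix, Iy, Iq} (row_poly J_indet (Var Iq)) \<and>
      coeffwise_log_convex 3 {Ia, Ib, Ic, Iu, Iv, Ix, Iy, Iq} (row_poly J_indet (Var Iq)) \<and>
      coeffwise_Hankel_TP {Ia, Ib, Ic, Iu, Iv, Ix, Iy, Iq} (rev_row_poly J_indet (Var Iq)) \<and>
      coeffwise_log_convex 3 {Ia, Ib, Ic, Iu, Iv, Ix, Iy, Iq} (rev_row_poly J_indet (Var Iq)))
     \<and>
     (coeffwise_Hankel_TP {Ia, Ib, Ic, Iu, Iv, Ix, Iy} (\<lambda>n. J_indet n 0) \<and>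
      coeffwise_log_convex 3 {Ia, Ib, Ic, Iu, Iv, Ix, Iy, Iq} (\<lambda>n. J_indet n 0))
     \<and>
     (\<forall>a b c u v x y :: real.
        a \<ge> 0 \<and> b \<ge> 0 \<and> c \<ge> 0 \<and> u \<ge> 0 \<and> v \<ge> 0 \<and> x \<ge> 0 \<and> y \<ge> 0 \<longrightarrow>
        (\<forall>s t. Stieltjes_moment_seq s \<and> Stieltjes_moment_seq t \<longrightarrow>
           Stieltjes_moment_seq (\<lambda>n. \<Sum>k\<le>n. Jmat a b c u v x y n k * s k * t (n - k))))"
proof -
  let ?Z = "{Ia, Ib, Ic, Iu, Iv, Ix, Iy, Iq}" and ?Z' = "{Ia, Ib, Ic, Iu, Iv, Ix, Iy}"
  interpret Z: positive_cone "{p :: (indet, real) mpoly. coeffwise_nonneg ?Z p}"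
    by (rule positive_cone_coeffwise_nonneg)
  interpret Z': positive_cone "{p :: (indet, real) mpoly. coeffwise_nonneg ?Z' p}"
    by (rule positive_cone_coeffwise_nonneg)
  have var: "Var i \<in> {p. coeffwise_nonneg ?Z p}" if "i \<in> ?Z" for i
    using coeffwise_nonneg_Var[OF that] by simp
  have var': "Var i \<in> {p. coeffwise_nonneg ?Z' p}" if "i \<in> ?Z'" for i
    using coeffwise_nonneg_Var[OF that] by simp
  have i: "coeffwise_TP ?Z (lower_mult J_indet (binomial_mat (Var Iq)))"
    unfolding coeffwise_TP_eq by (intro Z.TP_Jmat var) simp_all
  have ii: "coeffwise_Hankel_TP ?Z (row_poly J_indet (Var Iq))"
    unfolding coeffwise_Hankel_TP_def coeffwise_TP_eq by (intro Z.TP_Jmat var) simp_all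
  have ii_rev: "coeffwise_Hankel_TP ?Z (rev_row_poly J_indet (Var Iq))"
    unfolding coeffwise_Hankel_TP_def coeffwise_TP_eq rev_row_poly_Jmat
    by (intro Z.TP_Jmat Z.mult_mem Z.one_mem var) simp_all
  have "coeffwise_Hankel_TP ?Z' (row_poly J_indet 0)"
    unfolding coeffwise_Hankel_TP_def coeffwise_TP_eq
    by (intro Z'.TP_Jmat Z'.zero_mem var') simp_all
  then have iii: "coeffwise_Hankel_TP ?Z' (\<lambda>n. J_indet n 0)"
    by (simp add: row_poly_0[abs_def])
  \<comment> \<open>Log-convexity is stated over the indeterminates including \<open>Iq\<close>,
    total positivity over the smaller set.\<close>
  then have "coeffwise_Hankel_TP ?Z (\<lambda>n. J_indet n 0)"
    unfolding coeffwise_Hankel_TP_def by (rule coeffwise_TP_mono) auto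
  with i ii ii_rev iii show ?thesis
    by (intro conjI allI impI coeffwise_log_convex_3)
      (auto intro: Jmat_convolution_Stieltjes)
qed

end
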